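(* Let $q\ge8$ be a power of $2$. Let $\mathcal O_{1}$ be the $G_q$-orbit of size $q+1$ and $\mathcal O_{2}$ the $G_q$-orbit of size $q^2-1$ into which the U$\Gamma$-lines split. Then: $\Pi_{\Gamma,1}=\Pi_{\Gamma,2}=\Lambda_{1,\Gamma}=\Lambda_{1,2_{\mathcal C}}=\Lambda_{2,\overline{1_{\mathcal C}}}=1$; $\Pi_{2_{\mathcal C},1}=q$; $\Pi_{\pi,1}=\Lambda_{1,\pi}=0$ for $\pi\in\{3_{\mathcal C},\overline{1_{\mathcal C}},0_{\mathcal C}\}$; $\Pi_{3_{\mathcal C},2}=\Pi_{\overline{1_{\mathcal C}},2}=q/2$; $\Pi_{\pi,2}=\Lambda_{2,\pi}=0$ for $\pi\in\{2_{\mathcal C},0_{\mathcal C}\}$; $\Lambda_{2,\Gamma}=q-1$; $\Lambda_{2,3_{\mathcal C}}=3$. Here $\Pi_{\pi,j}$ is the number of $\pi$-planes through any line of $\mathcal O_j$ and $\Lambda_{j,\pi}$ is the number of lines of $\mathcal O_j$ contained in a $\pi$-plane.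
   Context: Let $\mathrm{PG}(3,q)$ have points $\mathbf{P}(x_0,x_1,x_2,x_3)$; put $P(t)=\mathbf{P}(t^3,t^2,t,1)$ ($t\in\mathbb{F}_q$), $P(\infty)=\mathbf{P}(1,0,0,0)$, $\mathcal{C}=\{P(t):t\in\mathbb{F}_q\cup\{\infty\}\}$ the twisted cubic, $G_q$ the group of projectivities fixing $\mathcal C$. Write $\boldsymbol{\pi}(c_0,c_1,c_2,c_3)$ for the plane $c_0x_0+c_1x_1+c_2x_2+c_3x_3=0$. $\Gamma$-planes: osculating planes $\boldsymbol{\pi}(1,-3t,3t^2,-t^3)$ ($t\in\mathbb{F}_q$) and $\boldsymbol{\pi}(0,0,0,1)$. A $d_{\mathcal C}$-plane ($d\in\{0,2,3\}$) contains exactly $d$ points of $\mathcal C$; a $\overline{1_{\mathcal C}}$-plane is a non-$\Gamma$-plane with exactly one point of $\mathcal C$ (each plane type is a $G_q$-orbit for $q\ge5$). The tangent at $P(t)$ is the line through $P(t)$ and $\mathbf{P}(3t^2,2t,1,0)$ ($t\in\mathbb{F}_q$), resp. through $P(\infty)$ and $\mathbf{P}(0,1,0,0)$. A U$\Gamma$-line is a line meeting $\mathcal C$ in exactly one point, not a tangent, lying in some $\Gamma$-plane. Known fact: for even $q\ge8$ the U$\Gamma$-lines form exactly two $G_q$-orbits, of sizes $q+1$ and $q^2-1$; the orbit of size $q+1$ consists of the lines of the regulus complementary to that of the tangents and is the orbit of the line through $\mathbf{P}(0,0,0,1)$ and $\mathbf{P}(0,1,0,0)$, while the orbit of size $q^2-1$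 is the orbit of the line through $\mathbf{P}(0,0,0,1)$ and $\mathbf{P}(0,1,1,0)$. *)

theory Defs
  imports "HOL-Analysis.Analysis" "HOL-Library.FuncSet"
begin

text \<open>
  PG(3,q) over a finite field \<^typ>\<open>'a\<close> with \<open>q\<close> elements: points, lines and planes are the
  subspaces of \<^typ>\<open>'a ^ 4\<close> of vector-space dimension 1, 2 and 3, and incidence is inclusion.
  The homogeneous coordinates \<open>x\<^sub>0, x\<^sub>1, x\<^sub>2, x\<^sub>3\<close> are the components \<open>x $ 1, x $ 2, x $ 3, x $ 4\<close>.
\<close>

definition pg_lines :: "('a::{field,finite} ^ 4) set set" where
  "pg_lines = {S. vec.subspace S \<and> vec.dim S = 2}"

definition pg_planes :: "('a::{field,finite} ^ 4) set set" where
  "pg_planes = {S. vec.subspace S \<and> vec.dim S = 3}"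

definition point :: "'a::{field,finite} \<Rightarrow> 'a \<Rightarrow> 'a \<Rightarrow> 'a \<Rightarrow> ('a ^ 4) set" where
  "point x0 x1 x2 x3 = vec.span {vector [x0, x1, x2, x3]}"

definition plane :: "'a::{field,finite} \<Rightarrow> 'a \<Rightarrow> 'a \<Rightarrow> 'a \<Rightarrow> ('a ^ 4) set" where
  "plane c0 c1 c2 c3 = {x. c0 * x $ 1 + c1 * x $ 2 + c2 * x $ 3 + c3 * x $ 4 = 0}"

definition join :: "('a::{field,finite} ^ 4) set \<Rightarrow> ('a ^ 4) set \<Rightarrow> ('a ^ 4) set" where
  "join S T = vec.span (S \<union> T)"

definition twisted_cubic :: "('a::{field,finite} ^ 4) set set" where
  "twisted_cubic = insert (point 1 0 0 0) (range (\<lambda>t. point (t^3) (t^2) t 1))"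

text \<open>
  A projectivity is the action of an invertible matrix on subspaces; restricting it to subspaces
  identifies proportional matrices, so these maps form the group PGL(4,q).
\<close>

definition projectivity :: "'a::{field,finite} ^ 4 ^ 4 \<Rightarrow> ('a ^ 4) set \<Rightarrow> ('a ^ 4) set" where
  "projectivity A = restrict (\<lambda>S. (*v) A ` S) {S. vec.subspace S}"

definition cubic_group :: "(('a::{field,finite} ^ 4) set \<Rightarrow> ('a ^ 4) set) set" where
  "cubic_group = {projectivity A | A. invertible A \<and> projectivity A ` twisted_cubic = twisted_cubic}"

definition tangents :: "('a::{field,finite} ^ 4) set set" where
  "tangents = insert (join (point 1 0 0 0) (point 0 1 0 0))
     (range (\<lambda>t. join (point (t^3) (t^2) t 1) (point (3 * t^2) (2 * t) 1 0)))"

definition Gamma_planes :: "('a::{field,finite} ^ 4) set set" where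
  "Gamma_planes = insert (plane 0 0 0 1)
     (range (\<lambda>t. plane 1 (- (3 * t)) (3 * t^2) (- (t^3))))"

definition d_planes :: "nat \<Rightarrow> ('a::{field,finite} ^ 4) set set" where
  "d_planes d = {p \<in> pg_planes. card {x \<in> twisted_cubic. x \<subseteq> p} = d}"

definition one_bar_planes :: "('a::{field,finite} ^ 4) set set" where
  "one_bar_planes = d_planes 1 - Gamma_planes"

definition UGamma_lines :: "('a::{field,finite} ^ 4) set set" where
  "UGamma_lines = {l \<in> pg_lines. card {x \<in> twisted_cubic. x \<subseteq> l} = 1 \<and> l \<notin> tangents
     \<and> (\<exists>p \<in> Gamma_planes. l \<subseteq> p)}"

definition UGamma_orbits :: "('a::{field,finite} ^ 4) set set set" where
  "UGamma_orbits = {{g l | g. g \<in> cubic_group} | l. l \<in> UGamma_lines}"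

definition planes_through :: "('a::{field,finite} ^ 4) set set \<Rightarrow> ('a ^ 4) set \<Rightarrow> nat" where
  "planes_through T l = card {p \<in> T. l \<subseteq> p}"

definition lines_in :: "('a::{field,finite} ^ 4) set set \<Rightarrow> ('a ^ 4) set \<Rightarrow> nat" where
  "lines_in L p = card {l \<in> L. l \<subseteq> p}"

end

theory Submission
  imports Defs "HOL-Computational_Algebra.Polynomial"
begin

text \<open>
  In characteristic 2 a line that meets the cubic only at \<open>P(t)\<close>, lies in an osculating plane and is
  not a tangent joins \<open>P(t)\<close> to \<open>R(t) + u T(t)\<close>, where \<open>T(t) = (t\<^sup>2, 0, 1, 0)\<close> is a point of the
  tangent and \<open>R(t) = (t, 1, 0, 0)\<close> a point of the regulus line at \<open>P(t)\<close>.  The maps \<open>t \<mapsto> t + c\<close>,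
  \<open>t \<mapsto> a t\<close> and \<open>t \<mapsto> 1 / t\<close> act transitively on the \<open>q + 1\<close> lines with \<open>u = 0\<close> and on the
  \<open>q\<^sup>2 - 1\<close> lines with \<open>u \<noteq> 0\<close>.  So an orbit of the full group contains one of these two sets,
  and the given sizes force equality; the full group need not be determined.

  A plane with coefficients \<open>c\<close> meets the cubic in the roots, on the projective line, of
  \<open>f = c\<^sub>0 x\<^sup>3 + c\<^sub>1 x\<^sup>2 + c\<^sub>2 x + c\<^sub>3\<close>.  It contains \<open>T(t)\<close> iff \<open>f'(t) = 0\<close>, and at a root \<open>t\<close> it
  contains \<open>R(t)\<close> iff \<open>f\<close> is \<open>x - t\<close> times the square of a linear form.  Hence a simple root gives
  exactly one line, with \<open>u = 0\<close> precisely if the other root is double; a double root that is not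
  triple gives none; and a triple root, i.e. an osculating plane, gives all of them.  Through a
  line with \<open>u \<noteq> 0\<close> the planes other than the osculating one have simple roots only, and half of them
  split because the map \<open>y \<mapsto> y\<^sup>2 + y\<close> is two-to-one.
\<close>

subsection \<open>Subspaces of the projective space\<close>

lemma vector_4 [simp]:
  "(vector [x, y, z, w] :: 'a::zero ^ 4) $ 1 = x"
  "(vector [x, y, z, w] :: 'a ^ 4) $ 2 = y"
  "(vector [x, y, z, w] :: 'a ^ 4) $ 3 = z"
  "(vector [x, y, z, w] :: 'a ^ 4) $ 4 = w"
  unfolding vector_def by simp_all

lemma subspace_plane: "vec.subspace (plane c0 c1 c2 c3)"
proof (rule vec.subspaceI)
  fix x y :: "'a ^ 4" and c :: 'a
  assume x: "x \<in> plane c0 c1 c2 c3"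
  have "c0 * (c * x $ 1) + c1 * (c * x $ 2) + c2 * (c * x $ 3) + c3 * (c * x $ 4)
      = c * (c0 * x $ 1 + c1 * x $ 2 + c2 * x $ 3 + c3 * x $ 4)"
    by (simp add: algebra_simps)
  then show "c *s x \<in> plane c0 c1 c2 c3"
    using x by (simp add: plane_def)
  assume y: "y \<in> plane c0 c1 c2 c3"
  have "c0 * (x $ 1 + y $ 1) + c1 * (x $ 2 + y $ 2) + c2 * (x $ 3 + y $ 3) + c3 * (x $ 4 + y $ 4)
      = (c0 * x $ 1 + c1 * x $ 2 + c2 * x $ 3 + c3 * x $ 4)
      + (c0 * y $ 1 + c1 * y $ 2 + c2 * y $ 3 + c3 * y $ 4)"
    by (simp add: algebra_simps)
  then show "x + y \<in> plane c0 c1 c2 c3"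
    using x y by (simp add: plane_def)
qed (simp add: plane_def)

lemma plane_neq_UNIV:
  fixes c0 c1 c2 c3 :: "'a::{field,finite}"
  assumes "\<not> (c0 = 0 \<and> c1 = 0 \<and> c2 = 0 \<and> c3 = 0)"
  obtains v where "v \<notin> plane c0 c1 c2 c3"
proof -
  have "vector [1, 0, 0, 0] \<notin> plane c0 c1 c2 c3 \<or> vector [0, 1, 0, 0] \<notin> plane c0 c1 c2 c3 \<or>
        vector [0, 0, 1, 0] \<notin> plane c0 c1 c2 c3 \<or> vector [0, 0, 0, 1] \<notin> plane c0 c1 c2 c3"
    using assms by (simp add: plane_def)
  then show thesis using that by blast
qed

text \<open>A vector \<open>v\<close> off the plane makes the linear form \<open>?f\<close> nonzero
  at \<open>v\<close>, so subtracting \<open>?f x / ?f v\<close> times \<open>v\<close> moves any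
  \<open>x\<close> into the plane. Hence the plane has codimension one.\<close>

lemma dim_plane:
  fixes c0 c1 c2 c3 :: "'a::{field,finite}"
  assumes "\<not> (c0 = 0 \<and> c1 = 0 \<and> c2 = 0 \<and> c3 = 0)"
  shows "vec.dim (plane c0 c1 c2 c3) = 3"
proof -
  let ?p = "plane c0 c1 c2 c3"
  let ?f = "\<lambda>x. c0 * x $ 1 + c1 * x $ 2 + c2 * x $ 3 + c3 * x $ 4"
  obtain v where v: "v \<notin> ?p"
    using assms by (rule plane_neq_UNIV)
  then have fv: "?f v \<noteq> 0" by (simp add: plane_def)
  have "x \<in> vec.span (insert v ?p)" for x
  proof -
    have "?f (x - k *s v) = ?f x - k * ?f v" for k
      by (simp add: algebra_simps)
    from this[of "?f x / ?f v"] have "?f (x - (?f x / ?f v) *s v) = 0"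
      by (simp only: nonzero_divide_eq_eq[OF fv] diff_self times_divide_eq_left)
        (simp only: nonzero_mult_div_cancel_right[OF fv] diff_self)
    then have "x - (?f x / ?f v) *s v \<in> ?p" by (simp add: plane_def)
    then show ?thesis
      unfolding vec.span_breakdown_eq using vec.span_base by blast
  qed
  then have "vec.span (insert v ?p) = UNIV" by blast
  then have "vec.dim (insert v ?p) = CARD(4)"
    by (metis vec.dim_span vec_dim_card)
  moreover have "v \<notin> vec.span ?p"
    using v subspace_plane vec.span_eq_iff by blast
  ultimately show ?thesis by (simp add: vec.dim_insert)
qed

lemma plane_in_pg_planes:
  fixes c0 c1 c2 c3 :: "'a::{field,finite}"
  assumes "\<not> (c0 = 0 \<and> c1 = 0 \<and> c2 = 0 \<and> c3 = 0)"
  shows "plane c0 c1 c2 c3 \<in> pg_planes"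
  using subspace_plane dim_plane[OF assms] by (auto simp: pg_planes_def)

text \<open>The coefficients are a nonzero vector annihilated by a basis of \<open>p\<close>. They
  give a plane of the same dimension that contains \<open>p\<close>.\<close>

lemma pg_planeE:
  fixes p :: "('a::{field,finite} ^ 4) set"
  assumes "p \<in> pg_planes"
  obtains c0 c1 c2 c3 :: 'a where
    "\<not> (c0 = 0 \<and> c1 = 0 \<and> c2 = 0 \<and> c3 = 0)" "p = plane c0 c1 c2 c3"
proof -
  have sub: "vec.subspace p" and dim: "vec.dim p = 3"
    using assms by (auto simp: pg_planes_def)
  obtain B where B: "B \<subseteq> p" "p \<subseteq> vec.span B" "card B = 3"
    using vec.basis_exists[of p] dim by metis
  then obtain a b c where abc: "B = {a, b, c}"
    by (auto simp: card_3_iff)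
  \<comment> \<open>Repeating \<open>c\<close> pads the three basis vectors to a square matrix. Its
    rows span a proper subspace, so its kernel is nontrivial.\<close>
  define A :: "'a ^ 4 ^ 4" where "A = vector [a, b, c, c]"
  have "rows A \<subseteq> p"
  proof -
    have "A $ i \<in> p" for i
      using exhaust_4[of i] B(1) abc by (auto simp: A_def)
    then show ?thesis by (auto simp: rows_def row_def vec_lambda_eta)
  qed
  then have "vec.span (rows A) \<subseteq> p"
    using sub vec.span_minimal by blast
  moreover have "p \<noteq> UNIV"
    using dim vec_dim_card[where 'a='a and 'n=4] by auto
  ultimately have "vec.span (rows A) \<noteq> UNIV" by blast
  then obtain x where x: "x \<noteq> 0" "A *v x = 0"
    using matrix_left_invertible_ker[of A] matrix_left_invertible_span_rows_gen[of A] by blast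
  have "\<forall>i. A $ i \<in> plane (x $ 1) (x $ 2) (x $ 3) (x $ 4)"
    using x(2) by (auto simp: vec_eq_iff matrix_vector_mult_def plane_def sum_4 mult.commute)
  then have "B \<subseteq> plane (x $ 1) (x $ 2) (x $ 3) (x $ 4)"
    by (auto simp: abc forall_4 A_def)
  then have "p \<subseteq> plane (x $ 1) (x $ 2) (x $ 3) (x $ 4)"
    using B(2) subspace_plane vec.span_minimal by blast
  moreover from x(1) have nz: "\<not> (x $ 1 = 0 \<and> x $ 2 = 0 \<and> x $ 3 = 0 \<and> x $ 4 = 0)"
    by (simp add: vec_eq_iff forall_4)
  then have "vec.dim (plane (x $ 1) (x $ 2) (x $ 3) (x $ 4)) = 3"
    by (rule dim_plane)
  ultimately have "p = plane (x $ 1) (x $ 2) (x $ 3) (x $ 4)"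
    using sub dim subspace_plane by (intro vec.subspace_dim_equal) auto
  with nz show thesis by (rule that)
qed

lemma plane_scale:
  fixes k :: "'a::{field,finite}"
  assumes "k \<noteq> 0"
  shows "plane (k * c0) (k * c1) (k * c2) (k * c3) = plane c0 c1 c2 c3"
proof -
  have "k * c0 * x $ 1 + k * c1 * x $ 2 + k * c2 * x $ 3 + k * c3 * x $ 4
      = k * (c0 * x $ 1 + c1 * x $ 2 + c2 * x $ 3 + c3 * x $ 4)" for x :: "'a ^ 4"
    by (simp add: algebra_simps)
  then show ?thesis using assms by (simp add: plane_def)
qed

lemma span_subset_iff: "vec.subspace p \<Longrightarrow> vec.span S \<subseteq> p \<longleftrightarrow> S \<subseteq> p"
  using vec.span_minimal[of S p] vec.span_superset[of S] by blast

lemma subspace_pg_plane: "p \<in> pg_planes \<Longrightarrow> vec.subspace p"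
  by (simp add: pg_planes_def)

text \<open>The linear form of \<open>p\<close> is affine in \<open>u\<close>, with slope its value
  at \<open>w\<close>, which is nonzero. With \<open>w\<close> a tangent point this singles out one
  line \<open>uline r u\<close> at each root.\<close>

lemma ex1_point_on_pencil:
  fixes p :: "('a::{field,finite} ^ 4) set"
  assumes "p \<in> pg_planes" "w \<notin> p"
  shows "\<exists>!u. v + u *s w \<in> p"
proof -
  obtain c0 c1 c2 c3 where p: "p = plane c0 c1 c2 c3"
    using assms(1) by (rule pg_planeE)
  let ?f = "\<lambda>x. c0 * x $ 1 + c1 * x $ 2 + c2 * x $ 3 + c3 * x $ 4"
  have p': "x \<in> p \<longleftrightarrow> ?f x = 0" for x
    by (simp add: p plane_def)
  have "?f (v + u *s w) = ?f v + u * ?f w" for u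
    by (simp add: algebra_simps)
  moreover have "a + u * b = 0 \<longleftrightarrow> u = - a / b" if "b \<noteq> 0" for a b u :: 'a
    using that by (metis add.commute eq_neg_iff_add_eq_0 nonzero_eq_divide_eq)
  ultimately have "v + u *s w \<in> p \<longleftrightarrow> u = - ?f v / ?f w" for u
    using assms(2) unfolding p' by presburger
  then show ?thesis by simp
qed

text \<open>Translation by 1 permutes the field, so comparing the sums of all elements gives that
  \<open>CARD('a)\<close> vanishes in the field. A power of 2 vanishes only if 2 does.\<close>

lemma two_eq_0_of_card:
  assumes "CARD('a::{field,finite}) = 2 ^ m"
  shows "(2::'a) = 0"
proof -
  have "(\<Sum>x\<in>(UNIV::'a set). x + 1) = (\<Sum>x\<in>UNIV. x)"
    by (rule sum.reindex_bij_witness[of _ "\<lambda>x. x - 1" "\<lambda>x. x + 1"]) auto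
  then have "(of_nat CARD('a) :: 'a) = 0"
    by (simp add: sum.distrib)
  then show ?thesis
    unfolding assms by simp
qed

section \<open>Parametrised points, lines and osculating planes\<close>

text \<open>
  \<^const>\<open>None\<close> is the parameter \<open>\<infinity>\<close>.  The formulas below drop the coefficients of
  tangents and osculating planes that vanish, and the signs, in characteristic 2.
\<close>

fun cubic_pt :: "'a::{field,finite} option \<Rightarrow> 'a ^ 4" where
  "cubic_pt None = vector [1, 0, 0, 0]"
| "cubic_pt (Some t) = vector [t ^ 3, t ^ 2, t, 1]"

fun tangent_pt :: "'a::{field,finite} option \<Rightarrow> 'a ^ 4" where
  "tangent_pt None = vector [0, 1, 0, 0]"
| "tangent_pt (Some t) = vector [t ^ 2, 0, 1, 0]"

fun regulus_pt :: "'a::{field,finite} option \<Rightarrow> 'a ^ 4" where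
  "regulus_pt None = vector [0, 0, 1, 0]"
| "regulus_pt (Some t) = vector [t, 1, 0, 0]"

fun osc_plane :: "'a::{field,finite} option \<Rightarrow> ('a ^ 4) set" where
  "osc_plane None = plane 0 0 0 1"
| "osc_plane (Some t) = plane 1 t (t ^ 2) (t ^ 3)"

text \<open>The tangent at the same point is the missing value \<open>u = \<infinity>\<close>.\<close>

definition uline :: "'a::{field,finite} option \<Rightarrow> 'a \<Rightarrow> ('a ^ 4) set" where
  "uline r u = vec.span {cubic_pt r, regulus_pt r + u *s tangent_pt r}"

lemma twisted_cubic_eq:
  "twisted_cubic = range (\<lambda>r::'a::{field,finite} option. vec.span {cubic_pt r})"
proof -
  have "range (\<lambda>r::'a option. vec.span {cubic_pt r}) = (\<lambda>r. vec.span {cubic_pt r}) ` insert None (range Some)"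
    by (simp add: UNIV_option_conv)
  then show ?thesis
    by (simp add: twisted_cubic_def point_def image_image)
qed

lemma subspace_uline: "vec.subspace (uline r u)"
  by (simp add: uline_def)

lemma uline_subset_iff:
  "vec.subspace p \<Longrightarrow>
    uline r u \<subseteq> p \<longleftrightarrow> cubic_pt r \<in> p \<and> regulus_pt r + u *s tangent_pt r \<in> p"
  by (simp add: uline_def span_subset_iff)

lemma cubic_pt_in_uline: "cubic_pt r \<in> uline r u"
  by (simp add: uline_def vec.span_base)

lemma subspace_osc_plane: "vec.subspace (osc_plane r)"
  by (cases r) (simp_all add: subspace_plane)

lemma osc_plane_in_pg_planes: "osc_plane r \<in> pg_planes"
  by (cases r) (auto intro!: plane_in_pg_planes)

subsection \<open>The group of the cubic\<close>

lemma span_pair_scale: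
  fixes a b :: "'a::{field,finite} ^ 4"
  assumes "k \<noteq> 0" "j \<noteq> 0"
  shows "vec.span {k *s a, j *s b} = vec.span {a, b}"
proof -
  have "a \<in> vec.span {k *s a, j *s b}"
    using vec.span_scale[of "k *s a" "{k *s a, j *s b}" "1 / k"] assms(1)
    by (simp add: vec.span_base)
  moreover have "b \<in> vec.span {k *s a, j *s b}"
    using vec.span_scale[of "j *s b" "{k *s a, j *s b}" "1 / j"] assms(2)
    by (simp add: vec.span_base)
  ultimately show ?thesis
    unfolding vec.span_eq by (simp add: vec.span_base vec.span_scale)
qed

lemma pg_line_eq_span:
  fixes l :: "('a::{field,finite} ^ 4) set"
  assumes "l \<in> pg_lines" "a \<in> l" "w \<in> l" "a \<noteq> 0" "w \<notin> vec.span {a}"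
  shows "l = vec.span {a, w}"
proof -
  have l: "vec.subspace l" "vec.dim l = 2"
    using assms(1) by (simp_all add: pg_lines_def)
  have "vec.dim {a} = 1"
    using assms(4) vec.dim_insert[of a "{}"] by simp
  then have "vec.dim (vec.span {a, w}) = 2"
    using assms(5) vec.dim_insert[of w "{a}"] by (simp add: insert_commute)
  moreover have "vec.span {a, w} \<subseteq> l"
    using l(1) assms(2,3) by (simp add: span_subset_iff)
  ultimately have "vec.span {a, w} = l"
    using l(2) by (intro vec.subspace_dim_equal[OF vec.subspace_span l(1)]) simp_all
  then show ?thesis ..
qed

text \<open>Working with matrices rather than with the restricted maps of
  \<open>projectivity\<close> turns composition and inversion into matrix products. Proportional
  matrices are not identified, which leaves the orbits unchanged.\<close>

definition cubic_matrices :: "('a::{field,finite} ^ 4 ^ 4) set" where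
  "cubic_matrices = {A. invertible A \<and> (\<lambda>S. (*v) A ` S) ` twisted_cubic = twisted_cubic}"

lemma subspace_twisted_cubic: "x \<in> twisted_cubic \<Longrightarrow> vec.subspace x"
  by (auto simp: twisted_cubic_eq)

lemma cubic_group_eq: "cubic_group = projectivity ` cubic_matrices"
proof -
  have "projectivity A ` twisted_cubic = (\<lambda>S. (*v) A ` S) ` twisted_cubic" for A :: "'a ^ 4 ^ 4"
    by (intro image_cong) (simp_all add: projectivity_def subspace_twisted_cubic)
  then show ?thesis
    by (auto simp: cubic_group_def cubic_matrices_def)
qed

lemma orbit_eq:
  assumes "vec.subspace l"
  shows "{g l | g. g \<in> cubic_group} = {(*v) A ` l | A. A \<in> cubic_matrices}"
proof -
  have "projectivity A l = (*v) A ` l" for A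
    using assms by (simp add: projectivity_def)
  then show ?thesis
    unfolding Setcompr_eq_image cubic_group_eq image_image by simp
qed

lemma cubic_matrices_mult:
  assumes "A \<in> cubic_matrices" "B \<in> cubic_matrices"
  shows "A ** B \<in> cubic_matrices"
proof -
  have "(\<lambda>S. (*v) (A ** B) ` S) ` twisted_cubic
      = (\<lambda>S. (*v) A ` S) ` (\<lambda>S. (*v) B ` S) ` twisted_cubic"
    by (simp add: image_image matrix_vector_mul_assoc)
  also have "\<dots> = twisted_cubic"
    using assms by (simp only: cubic_matrices_def mem_Collect_eq)
  finally show ?thesis
    using assms by (simp add: cubic_matrices_def invertible_mult)
qed

text \<open>The inverse is stated by its effect on sets of vectors, the form in which lines and
  planes are moved back.\<close>

lemma cubic_matrices_inverse:
  fixes A :: "'a::{field,finite} ^ 4 ^ 4"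
  assumes "A \<in> cubic_matrices"
  obtains B where "B \<in> cubic_matrices" "\<forall>S. (*v) B ` (*v) A ` S = S"
proof -
  obtain B where B: "A ** B = mat 1" "B ** A = mat 1"
    using assms by (auto simp: cubic_matrices_def invertible_def)
  then have im: "(*v) B ` (*v) A ` S = S" "(*v) A ` (*v) B ` S = S" for S
    by (simp_all add: image_image matrix_vector_mul_assoc)
  have "(\<lambda>S. (*v) B ` S) ` (\<lambda>S. (*v) A ` S) ` twisted_cubic = twisted_cubic"
    unfolding image_image[of "\<lambda>S. (*v) B ` S"] im by simp
  then have "B \<in> cubic_matrices"
    using assms B by (auto simp: cubic_matrices_def invertible_def)
  with im(1) show thesis by (intro that allI)
qed

text \<open>The cubic is finite, so an injective map that sends it into itself is onto. The scalar
  \<open>k\<close> is the freedom of homogeneous coordinates.\<close>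

lemma cubic_matricesI:
  fixes A :: "'a::{field,finite} ^ 4 ^ 4"
  assumes ker: "\<And>x. A *v x = 0 \<Longrightarrow> x = 0"
    and pts: "\<And>r. \<exists>k s. k \<noteq> 0 \<and> A *v cubic_pt r = k *s cubic_pt s"
  shows "A \<in> cubic_matrices"
proof -
  let ?f = "\<lambda>S. (*v) A ` S"
  have inv: "invertible A"
    using ker by (simp add: invertible_left_inverse matrix_left_invertible_ker)
  then have inj: "inj ((*v) A)"
    by (rule inj_matrix_vector_mult)
  have "?f ` twisted_cubic \<subseteq> twisted_cubic"
  proof
    fix x assume "x \<in> ?f ` twisted_cubic"
    then obtain r where "x = ?f (vec.span {cubic_pt r})"
      by (auto simp: twisted_cubic_eq)
    then have x: "x = vec.span {A *v cubic_pt r}"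
      by (simp add: vec.span_image[symmetric])
    obtain k s where "k \<noteq> 0" "A *v cubic_pt r = k *s cubic_pt s"
      using pts by blast
    then have "x = vec.span {cubic_pt s}"
      using x span_pair_scale[of k k "cubic_pt s" "cubic_pt s"] by simp
    then show "x \<in> twisted_cubic" by (simp add: twisted_cubic_eq)
  qed
  moreover have "inj_on ?f twisted_cubic"
    using inj by (auto simp: inj_on_def inj_image_eq_iff)
  ultimately have "?f ` twisted_cubic = twisted_cubic"
    by (intro endo_inj_surj) simp_all
  with inv show ?thesis by (simp add: cubic_matrices_def)
qed

lemma image_uline:
  assumes "A *v cubic_pt r = k *s cubic_pt s"
    and "A *v (regulus_pt r + u *s tangent_pt r) = j *s (regulus_pt s + v *s tangent_pt s)"
    and "k \<noteq> 0" "j \<noteq> 0"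
  shows "(*v) A ` uline r u = uline s v"
proof -
  have "(*v) A ` uline r u = vec.span ((*v) A ` {cubic_pt r, regulus_pt r + u *s tangent_pt r})"
    unfolding uline_def by (rule vec.span_image[symmetric])
  also have "\<dots> = vec.span {k *s cubic_pt s, j *s (regulus_pt s + v *s tangent_pt s)}"
    using assms(1,2) by simp
  also have "\<dots> = uline s v"
    unfolding uline_def using assms(3,4) by (rule span_pair_scale)
  finally show ?thesis .
qed

lemma inj_cubic_matrix: "A \<in> cubic_matrices \<Longrightarrow> inj ((*v) A)"
  by (simp add: cubic_matrices_def inj_matrix_vector_mult)

lemma pg_planes_image:
  assumes "A \<in> cubic_matrices" "p \<in> pg_planes"
  shows "(*v) A ` p \<in> pg_planes"
proof -
  have "vec.dim ((*v) A ` p) = vec.dim p"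
    using inj_cubic_matrix[OF assms(1)]
    by (intro vec.dim_image_eq matrix_vector_mul_linear_gen) (auto intro: inj_on_subset)
  then show ?thesis
    using assms(2) by (simp add: pg_planes_def vec.subspace_image)
qed

lemma d_planes_image:
  assumes "A \<in> cubic_matrices" "p \<in> d_planes d"
  shows "(*v) A ` p \<in> d_planes d"
proof -
  let ?f = "\<lambda>S. (*v) A ` S"
  note inj = inj_cubic_matrix[OF assms(1)]
  have C: "twisted_cubic = ?f ` twisted_cubic"
    using assms(1) by (simp add: cubic_matrices_def)
  have "{x \<in> ?f ` twisted_cubic. x \<subseteq> ?f p} = ?f ` {x \<in> twisted_cubic. x \<subseteq> p}"
    using inj_image_subset_iff[OF inj] by blast
  then have "{x \<in> twisted_cubic. x \<subseteq> ?f p} = ?f ` {x \<in> twisted_cubic. x \<subseteq> p}"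
    using C by simp
  moreover have "inj_on ?f {x \<in> twisted_cubic. x \<subseteq> p}"
    using inj by (auto simp: inj_on_def inj_image_eq_iff)
  ultimately have "card {x \<in> twisted_cubic. x \<subseteq> ?f p} = card {x \<in> twisted_cubic. x \<subseteq> p}"
    by (simp add: card_image)
  then show ?thesis
    using assms(2) pg_planes_image[OF assms(1)] by (simp add: d_planes_def)
qed

text \<open>A matrix injects the planes of \<open>T\<close> through \<open>l\<close> into those
  through the image of \<open>l\<close>. Applying the same bound to the inverse matrix gives
  equality.\<close>

lemma planes_through_image:
  fixes T :: "('a::{field,finite} ^ 4) set set"
  assumes T: "\<And>A p. A \<in> cubic_matrices \<Longrightarrow> p \<in> T \<Longrightarrow> (*v) A ` p \<in> T"
    and A: "A \<in> cubic_matrices"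
  shows "planes_through T ((*v) A ` l) = planes_through T l"
proof -
  have le: "planes_through T l \<le> planes_through T ((*v) A ` l)"
    if A: "A \<in> cubic_matrices" for A and l :: "('a ^ 4) set"
    unfolding planes_through_def
  proof (rule card_inj_on_le)
    show "inj_on (\<lambda>S. (*v) A ` S) {p \<in> T. l \<subseteq> p}"
      using inj_cubic_matrix[OF A] by (auto simp: inj_on_def inj_image_eq_iff)
  qed (use T[OF A] in auto)
  obtain B where B: "B \<in> cubic_matrices" "\<forall>S. (*v) B ` (*v) A ` S = S"
    using A by (rule cubic_matrices_inverse)
  show ?thesis
    using le[OF A, of l] le[OF B(1), of "(*v) A ` l"] by (simp add: B(2))
qed

subsection \<open>Lines and planes in characteristic 2\<close>

text \<open>Characteristic 2 is an assumption on the type, so that its rules \<open>- x = x\<close>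
  and \<open>x + x = 0\<close> are available to the simplifier throughout.\<close>

locale char_two_field =
  fixes ty :: "'a::{field,finite} itself"
  assumes two_eq_0: "(2::'a) = 0"
begin

lemma add_self [simp]: "(x::'a) + x = 0"
  using two_eq_0 by (metis mult_2 mult_zero_left)

lemma add_self_left [simp]: "(x::'a) + (x + y) = y"
  by (simp flip: add.assoc)

lemma minus_eq [simp]: "- (x::'a) = x"
  by (simp add: minus_unique)

lemma diff_eq [simp]: "(x::'a) - y = x + y"
  by (metis add_uminus_conv_diff minus_eq)

lemma add_eq_0_iff_eq: "(x::'a) + y = 0 \<longleftrightarrow> x = y"
  by (metis diff_eq right_minus_eq)

lemma three_eq_1: "(3::'a) = 1"
proof -
  have "(3::'a) = 2 + 1" by simp
  then show ?thesis using two_eq_0 by simp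
qed

lemma square_add: "((x::'a) + y)^2 = x^2 + y^2"
  by (simp add: power2_eq_square algebra_simps)

text \<open>Squaring is additive with trivial kernel, hence injective, and an injective self-map of
  a finite field is onto.\<close>

lemma ex_sqrt: "\<exists>y::'a. y^2 = x"
proof -
  have "inj (\<lambda>y::'a. y^2)"
    by (rule injI) (metis add_eq_0_iff_eq square_add zero_eq_power2)
  then have "surj (\<lambda>y::'a. y^2)"
    by (rule finite_UNIV_inj_surj[OF finite])
  then show ?thesis by (metis surjD)
qed

lemma Gamma_planes_eq: "Gamma_planes = range (osc_plane :: 'a option \<Rightarrow> _)"
proof -
  have "range (osc_plane :: 'a option \<Rightarrow> _) = osc_plane ` insert None (range Some)"
    by (simp add: UNIV_option_conv)
  then show ?thesis
    by (simp add: Gamma_planes_def image_image three_eq_1)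
qed

lemma tangents_eq: "tangents = range (\<lambda>r::'a option. vec.span {cubic_pt r, tangent_pt r})"
proof -
  have "join (point a b c d) (point a' b' c' d') = vec.span {vector [a, b, c, d], vector [a', b', c', d']}"
    for a b c d a' b' c' d' :: 'a
  proof -
    let ?v = "vector [a, b, c, d] :: 'a ^ 4" and ?w = "vector [a', b', c', d'] :: 'a ^ 4"
    have "vec.span {?v} \<union> vec.span {?w} \<subseteq> vec.span {?v, ?w}"
      by (intro Un_least vec.span_mono) auto
    moreover have "{?v, ?w} \<subseteq> vec.span (vec.span {?v} \<union> vec.span {?w})"
      by (simp add: vec.span_base)
    ultimately show ?thesis
      unfolding join_def point_def vec.span_eq by blast
  qed
  moreover have "range (\<lambda>r::'a option. vec.span {cubic_pt r, tangent_pt r})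
      = (\<lambda>r. vec.span {cubic_pt r, tangent_pt r}) ` insert None (range Some)"
    by (simp add: UNIV_option_conv)
  ultimately show ?thesis
    by (simp add: tangents_def image_image three_eq_1 two_eq_0)
qed

text \<open>The form of the osculating plane at \<open>Some t\<close>, evaluated at
  \<open>Some x\<close>, is the cube of \<open>x + t\<close>: the contact is triple.\<close>

lemma cubic_pt_in_osc_plane:
  fixes r s :: "'a option"
  shows "cubic_pt s \<in> osc_plane r \<longleftrightarrow> s = r"
proof (cases r; cases s)
  fix t x assume *: "r = Some t" "s = Some x"
  have "x^3 + t * x^2 + t^2 * x + t^3 = (x + t)^3"
    by (simp add: power3_eq_cube power2_eq_square algebra_simps)
  also have "\<dots> = 0 \<longleftrightarrow> x = t"
    by (simp add: add_eq_0_iff_eq)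
  finally show ?thesis using * by (simp add: plane_def)
qed (auto simp: plane_def)

text \<open>Each osculating plane contains only its own point of the cubic, so these planes separate
  the points.\<close>

lemma span_cubic_pt_eq_iff:
  fixes r s :: "'a option"
  shows "vec.span {cubic_pt r} = vec.span {cubic_pt s} \<longleftrightarrow> r = s"
  using cubic_pt_in_osc_plane[of r s] span_subset_iff[OF subspace_osc_plane, of _ s]
  by (metis cubic_pt_in_osc_plane empty_subsetI insert_subset order_refl)

lemma card_points_eq:
  fixes p :: "('a ^ 4) set"
  assumes "vec.subspace p"
  shows "card {x \<in> twisted_cubic. x \<subseteq> p} = card {r. cubic_pt r \<in> p}"
proof -
  have "{x \<in> twisted_cubic. x \<subseteq> p} = (\<lambda>r. vec.span {cubic_pt r}) ` {r. cubic_pt r \<in> p}"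
    unfolding twisted_cubic_eq using span_subset_iff[OF assms, of "{cubic_pt _}"] by auto
  moreover have "inj (\<lambda>r::'a option. vec.span {cubic_pt r})"
    by (simp add: inj_def span_cubic_pt_eq_iff)
  ultimately show ?thesis
    by (simp add: card_image inj_on_subset)
qed

lemma uline_subset_osc_plane:
  fixes r s :: "'a option"
  shows "uline r u \<subseteq> osc_plane s \<longleftrightarrow> r = s"
proof
  show "uline r u \<subseteq> osc_plane s \<Longrightarrow> r = s"
    using cubic_pt_in_osc_plane cubic_pt_in_uline by blast
  assume "r = s"
  then show "uline r u \<subseteq> osc_plane s"
    unfolding uline_subset_iff[OF subspace_osc_plane]
    by (cases s) (simp_all add: plane_def power2_eq_square power3_eq_cube algebra_simps)
qed

lemma in_osc_plane_if_in_uline: "x \<in> uline r u \<Longrightarrow> x \<in> osc_plane (r :: 'a option)"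
  using uline_subset_osc_plane by blast

text \<open>The osculating plane through the line recovers the parameter of its point. A further
  plane, chosen separately at infinity and at finite points, recovers \<open>u\<close>.\<close>

lemma uline_eq_iff:
  fixes r s :: "'a option"
  shows "uline r u = uline s v \<longleftrightarrow> r = s \<and> u = v"
proof
  assume eq: "uline r u = uline s v"
  then have rs: "r = s"
    using uline_subset_osc_plane by blast
  have "u = v"
  proof (cases r)
    case None
    then have "uline r u \<subseteq> plane 0 1 u 0"
      unfolding uline_subset_iff[OF subspace_plane] by (simp add: plane_def)
    then have "uline r v \<subseteq> plane 0 1 u 0" using eq rs by simp
    then show ?thesis
      unfolding uline_subset_iff[OF subspace_plane] using None by (simp add: plane_def add_eq_0_iff_eq)
  next
    case (Some t)
    \<comment> \<open>On the second generator of \<open>uline r v\<close> the form of this plane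
      takes the value \<open>u + v\<close>.\<close>
    then have "uline r u \<subseteq> plane 0 u 1 (u * t^2 + t)"
      unfolding uline_subset_iff[OF subspace_plane] by (simp add: plane_def add_eq_0_iff_eq)
    then have "uline r v \<subseteq> plane 0 u 1 (u * t^2 + t)" using eq rs by simp
    then show ?thesis
      unfolding uline_subset_iff[OF subspace_plane] using Some by (simp add: plane_def add_eq_0_iff_eq)
  qed
  with rs show "r = s \<and> u = v" by simp
qed simp

text \<open>The three incidences leave the coefficient vector only one degree of freedom, a scalar.
  This is the case of a triple root.\<close>

lemma osc_planeI:
  fixes r :: "'a option"
  assumes "p \<in> pg_planes" "cubic_pt r \<in> p" "tangent_pt r \<in> p" "regulus_pt r \<in> p"
  shows "p = osc_plane r"
proof -
  obtain c0 c1 c2 c3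
    where c: "\<not> (c0 = 0 \<and> c1 = 0 \<and> c2 = 0 \<and> c3 = 0)" and p: "p = plane c0 c1 c2 c3"
    using assms(1) by (rule pg_planeE)
  show ?thesis
  proof (cases r)
    case None
    then have "c0 = 0" "c1 = 0" "c2 = 0"
      using assms(2-4) by (simp_all add: p plane_def)
    moreover from this have "c3 \<noteq> 0"
      using c by auto
    ultimately show ?thesis
      using plane_scale[of "c3" 0 0 0 1] None by (simp add: p)
  next
    case (Some t)
    then have *: "c1 = c0 * t" "c2 = c0 * t ^ 2"
      using assms(3-4) by (simp_all add: p plane_def add_eq_0_iff_eq)
    moreover have "c3 = c0 * t ^ 3"
      using assms(2) Some
      by (simp add: p plane_def add_eq_0_iff_eq * power2_eq_square power3_eq_cube mult.assoc)
    moreover from calculation have "c0 \<noteq> 0"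
      using c by auto
    ultimately show ?thesis
      using plane_scale[of "c0" 1 t "t ^ 2" "t ^ 3"] Some by (simp add: p)
  qed
qed

subsection \<open>Roots of the cubic form of a plane\<close>

text \<open>Here \<open>f = (x + t)\<^sup>2 (c\<^sub>0 x + c\<^sub>1)\<close>.\<close>

lemma roots_of_tangent_in_plane:
  fixes r :: "'a option"
  assumes "p \<in> pg_planes" "cubic_pt r \<in> p" "tangent_pt r \<in> p" "regulus_pt r \<notin> p"
  obtains s where "s \<noteq> r" "{x. cubic_pt x \<in> p} = {r, s}" "regulus_pt s \<in> p" "tangent_pt s \<notin> p"
proof -
  obtain c0 c1 c2 c3 where p: "p = plane c0 c1 c2 c3"
    using assms(1) by (rule pg_planeE)
  have "\<exists>s. s \<noteq> r \<and> (\<forall>x. cubic_pt x \<in> p \<longleftrightarrow> x = r \<or> x = s) \<and> regulus_pt s \<in> p \<and> tangent_pt s \<notin> p"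
  proof (cases r)
    case None
    then have "c0 = 0" "c1 = 0" "c2 \<noteq> 0"
      using assms(2-4) by (simp_all add: p plane_def)
    moreover from this have "cubic_pt x \<in> p \<longleftrightarrow> x = None \<or> x = Some (c3 / c2)" for x
      by (cases x) (auto simp: p plane_def add_eq_0_iff_eq field_simps)
    ultimately show ?thesis
      using None by (intro exI[of _ "Some (c3 / c2)"]) (auto simp: p plane_def)
  next
    case (Some t)
    have c2: "c2 = c0 * t ^ 2" and nz: "c0 * t \<noteq> c1"
      using assms(3,4) Some by (simp_all add: p plane_def add_eq_0_iff_eq)
    have c3: "c3 = c1 * t ^ 2"
      using assms(2) Some
      by (simp add: p plane_def add_eq_0_iff_eq c2 power2_eq_square power3_eq_cube mult.assoc)
        (simp add: ac_simps two_eq_0)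
    have "c0 * x ^ 3 + c1 * x ^ 2 + c2 * x + c3 = (x ^ 2 + t ^ 2) * (c0 * x + c1)" for x
      by (simp add: c2 c3 power2_eq_square power3_eq_cube algebra_simps)
    then have f: "c0 * x ^ 3 + c1 * x ^ 2 + c2 * x + c3 = 0 \<longleftrightarrow> x = t \<or> c0 * x = c1" for x
      by (simp only: mult_eq_0_iff flip: square_add) (simp add: add_eq_0_iff_eq)
    show ?thesis
    proof (cases "c0 = 0")
      \<comment> \<open>The linear factor has become constant, so the remaining root is at
        infinity.\<close>
      case True
      then have "cubic_pt x \<in> p \<longleftrightarrow> x = Some t \<or> x = None" for x
        using nz f c2 by (cases x) (auto simp: p plane_def)
      then show ?thesis
        using Some nz c2 True by (intro exI[of _ None]) (auto simp: p plane_def)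
    next
      case False
      have "cubic_pt x \<in> p \<longleftrightarrow> x = Some t \<or> x = Some (c1 / c0)" for x
        using False f by (cases x) (auto simp: p plane_def field_simps)
      moreover have ne: "c1 / c0 \<noteq> t"
        using nz False by auto
      moreover have "tangent_pt (Some (c1 / c0)) \<notin> p"
      proof -
        have "c0 * (c1 / c0) ^ 2 + c2 = c0 * (c1 / c0 + t) ^ 2"
          by (simp only: c2 square_add distrib_left)
        then have "c0 * (c1 / c0) ^ 2 + c2 \<noteq> 0"
          using False ne by (simp add: add_eq_0_iff_eq)
        then show ?thesis
          by (simp add: p plane_def)
      qed
      moreover have "regulus_pt (Some (c1 / c0)) \<in> p"
        using False by (simp add: p plane_def)
      ultimately show ?thesis
        unfolding Some by (intro exI[of _ "Some (c1 / c0)"] conjI allI) simp_all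
    qed
  qed
  then show thesis using that by blast
qed

text \<open>Here \<open>f = (x + t) (c\<^sub>0 x\<^sup>2 + c\<^sub>2)\<close>, and the second factor is a square up to a scalar.\<close>

lemma roots_of_regulus_in_plane:
  fixes r :: "'a option"
  assumes "p \<in> pg_planes" "cubic_pt r \<in> p" "regulus_pt r \<in> p" "tangent_pt r \<notin> p"
  obtains s where "s \<noteq> r" "{x. cubic_pt x \<in> p} = {r, s}" "tangent_pt s \<in> p" "regulus_pt s \<notin> p"
proof -
  obtain c0 c1 c2 c3 where p: "p = plane c0 c1 c2 c3"
    using assms(1) by (rule pg_planeE)
  have "\<exists>s. s \<noteq> r \<and> (\<forall>x. cubic_pt x \<in> p \<longleftrightarrow> x = r \<or> x = s) \<and> tangent_pt s \<in> p \<and> regulus_pt s \<notin> p"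
  proof (cases r)
    case None
    then have c: "c0 = 0" "c2 = 0" "c1 \<noteq> 0"
      using assms(2-4) by (simp_all add: p plane_def)
    obtain y where y: "y ^ 2 = c3 / c1"
      using ex_sqrt by blast
    \<comment> \<open>The finite part of the form is a square up to a scalar, so its only root
      \<open>y\<close> is double.\<close>
    have "c1 * x ^ 2 + c3 = c1 * (x + y) ^ 2" for x
      using c by (simp add: square_add y distrib_left)
    then have "c1 * x ^ 2 + c3 = 0 \<longleftrightarrow> x = y" for x
      using c by (simp add: add_eq_0_iff_eq)
    then have "cubic_pt x \<in> p \<longleftrightarrow> x = None \<or> x = Some y" for x
      using c by (cases x) (auto simp: p plane_def)
    then show ?thesis
      using None c by (intro exI[of _ "Some y"]) (auto simp: p plane_def)
  next
    case (Some t)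
    have c1: "c1 = c0 * t" and nz: "c0 * t ^ 2 \<noteq> c2"
      using assms(3,4) Some by (simp_all add: p plane_def add_eq_0_iff_eq)
    have c3: "c3 = c2 * t"
      using assms(2) Some
      by (simp add: p plane_def add_eq_0_iff_eq c1 power2_eq_square power3_eq_cube mult.assoc)
    have "c0 * x ^ 3 + c1 * x ^ 2 + c2 * x + c3 = (x + t) * (c0 * x ^ 2 + c2)" for x
      by (simp add: c1 c3 power2_eq_square power3_eq_cube algebra_simps)
    then have f: "c0 * x ^ 3 + c1 * x ^ 2 + c2 * x + c3 = 0 \<longleftrightarrow> x = t \<or> c0 * x ^ 2 = c2" for x
      by (simp only: mult_eq_0_iff) (simp add: add_eq_0_iff_eq)
    show ?thesis
    proof (cases "c0 = 0")
      case True
      then have "cubic_pt x \<in> p \<longleftrightarrow> x = Some t \<or> x = None" for x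
        using nz f c1 by (cases x) (auto simp: p plane_def)
      then show ?thesis
        using Some nz c1 True
        by (intro exI[of _ None]) (auto simp: p plane_def)
    next
      case False
      obtain y where y: "y ^ 2 = c2 / c0"
        using ex_sqrt by blast
      have y': "c0 * x ^ 2 = c2 \<longleftrightarrow> x = y" for x
      proof -
        have "c0 * x ^ 2 + c2 = c0 * (x + y) ^ 2"
          using False by (simp add: square_add y distrib_left)
        then show ?thesis
          using False by (metis add_eq_0_iff_eq mult_eq_0_iff zero_eq_power2)
      qed
      then have "cubic_pt x \<in> p \<longleftrightarrow> x = Some t \<or> x = Some y" for x
        using False f by (cases x) (auto simp: p plane_def)
      moreover have "y \<noteq> t"
        using nz y' by blast
      moreover have "c0 * y \<noteq> c1"
        using c1 False \<open>y \<noteq> t\<close> by simp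
      moreover have "c0 * y ^ 2 = c2"
        using y' by blast
      ultimately show ?thesis
        using Some
        by (intro exI[of _ "Some y"]) (auto simp: p plane_def add_eq_0_iff_eq)
    qed
  qed
  then show thesis using that by blast
qed

text \<open>If \<open>f\<close> has two roots then it has a third one, counted with multiplicity.\<close>

lemma two_roots_tangent_in_plane:
  fixes r s :: "'a option"
  assumes "p \<in> pg_planes" "{x. cubic_pt x \<in> p} = {r, s}" "r \<noteq> s"
  shows "tangent_pt r \<in> p \<or> tangent_pt s \<in> p"
proof -
  obtain c0 c1 c2 c3 where p: "p = plane c0 c1 c2 c3"
    using assms(1) by (rule pg_planeE)
  have infinite_root: "tangent_pt None \<in> p \<or> tangent_pt (Some t) \<in> p"
    if roots: "{x. cubic_pt x \<in> p} = {None, Some t}" for t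
  proof (rule ccontr)
    assume neg: "\<not> ?thesis"
    have c0: "c0 = 0" and c3: "c3 = c1 * t ^ 2 + c2 * t"
      using eqset_imp_iff[OF roots, of None] eqset_imp_iff[OF roots, of "Some t"]
      by (auto simp: p plane_def add_eq_0_iff_eq)
    have nz: "c1 \<noteq> 0" "c2 \<noteq> 0"
      using neg c0 by (auto simp: p plane_def)
    \<comment> \<open>The form is quadratic here and its roots add up to \<open>c2 / c1\<close>. As
      this is nonzero, the partner of \<open>t\<close> is a new root.\<close>
    have "c1 * (t + c2 / c1) ^ 2 + c2 * (t + c2 / c1) + c3 = 0"
      using nz by (simp add: c3 square_add power2_eq_square distrib_left distrib_right ac_simps two_eq_0)
    then have "cubic_pt (Some (t + c2 / c1)) \<in> p"
      by (simp add: p plane_def c0)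
    then show False
      using eqset_imp_iff[OF roots, of "Some (t + c2 / c1)"] nz by simp
  qed
  have finite_roots: "tangent_pt (Some t) \<in> p \<or> tangent_pt (Some y) \<in> p"
    if roots: "{x. cubic_pt x \<in> p} = {Some t, Some y}" and ty: "t \<noteq> y" for t y
  proof (rule ccontr)
    assume neg: "\<not> ?thesis"
    have c0: "c0 \<noteq> 0" and t: "c0 * t ^ 3 + c1 * t ^ 2 + c2 * t + c3 = 0"
      and y: "c0 * y ^ 3 + c1 * y ^ 2 + c2 * y + c3 = 0"
      using eqset_imp_iff[OF roots, of None] eqset_imp_iff[OF roots, of "Some t"]
        eqset_imp_iff[OF roots, of "Some y"]
      by (auto simp: p plane_def)
    \<comment> \<open>Divided difference of the form: it yields \<open>c2\<close> from the roots
      \<open>t\<close> and \<open>y\<close>, and then shows that \<open>z\<close> is a root.\<close>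
    have diff: "(a - b) * (c0 * (a ^ 2 + a * b + b ^ 2) + c1 * (a + b) + c2)
       = (c0 * a ^ 3 + c1 * a ^ 2 + c2 * a + c3) - (c0 * b ^ 3 + c1 * b ^ 2 + c2 * b + c3)" for a b
      by (simp add: power2_eq_square power3_eq_cube algebra_simps)
    from this[of t y] have c2: "c2 = c0 * (t ^ 2 + t * y + y ^ 2) + c1 * (t + y)"
      using ty unfolding t y by (simp add: add_eq_0_iff_eq)
    \<comment> \<open>The third root, since by Vieta the three roots add up to
      \<open>c1 / c0\<close>.\<close>
    define z where "z = c1 / c0 + t + y"
    have "z + t + y = c1 / c0"
      by (simp add: z_def ac_simps)
    then have c1: "c1 = c0 * (z + t + y)"
      using c0 by simp
    have "c0 * (z ^ 2 + z * t + t ^ 2) + c1 * (z + t) + c2 = (z + y) * (c0 * (z + t + y) + c1)"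
      by (simp add: c2 power2_eq_square distrib_left distrib_right ac_simps two_eq_0)
    also have "\<dots> = 0"
      unfolding c1 by simp
    finally have "c0 * z ^ 3 + c1 * z ^ 2 + c2 * z + c3 = 0"
      using diff[of z t] by (simp add: t)
    then have "cubic_pt (Some z) \<in> p"
      by (simp add: p plane_def)
    then have "z = t \<or> z = y"
      using eqset_imp_iff[OF roots, of "Some z"] by simp
    \<comment> \<open>If \<open>z\<close> repeats \<open>t\<close> or \<open>y\<close>, the
      derivative \<open>c0 x^2 + c2\<close> vanishes at the repeated root, so its tangent point lies
      in \<open>p\<close>.\<close>
    then have "c1 = c0 * y \<or> c1 = c0 * t"
      using c1 by (auto simp: add.commute)
    then have "c2 = c0 * t ^ 2 \<or> c2 = c0 * y ^ 2"
      unfolding c2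
      by (auto simp: power2_eq_square distrib_left distrib_right ac_simps two_eq_0)
    then show False
      using neg by (auto simp: p plane_def)
  qed
  show ?thesis
    using assms(2,3) infinite_root finite_roots by (cases r; cases s) (auto simp: insert_commute)
qed

text \<open>At a root, tangent and regulus point together force an osculating plane. Either one
  alone yields the double-root case, in which \<open>r\<close> is the simple root and
  \<open>s\<close> the double one. The last case also covers planes without points of the
  cubic.\<close>

lemma plane_trichotomy:
  assumes "(p :: ('a ^ 4) set) \<in> pg_planes"
  obtains (osculating) r where "p = osc_plane r"
  | (double_root) r s where "r \<noteq> s" "{x. cubic_pt x \<in> p} = {r, s}"
      "regulus_pt r \<in> p" "tangent_pt r \<notin> p" "tangent_pt s \<in> p" "regulus_pt s \<notin> p"
  | (simple_roots) "\<And>r. cubic_pt r \<in> p \<Longrightarrow> tangent_pt r \<notin> p \<and> regulus_pt r \<notin> p"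
      "card {x. cubic_pt x \<in> p} \<noteq> 2"
proof (cases "\<forall>r. cubic_pt r \<in> p \<longrightarrow> tangent_pt r \<notin> p \<and> regulus_pt r \<notin> p")
  case True
  then have "card {x. cubic_pt x \<in> p} \<noteq> 2"
    using two_roots_tangent_in_plane[OF assms] unfolding card_2_iff by blast
  with True simple_roots show thesis by blast
next
  case False
  then obtain r where r: "cubic_pt r \<in> p" "tangent_pt r \<in> p \<or> regulus_pt r \<in> p" by blast
  show thesis
  proof (cases "tangent_pt r \<in> p"; cases "regulus_pt r \<in> p")
    assume "tangent_pt r \<in> p" "regulus_pt r \<in> p"
    then show thesis using osc_planeI[OF assms r(1)] osculating by blast
  next
    assume *: "tangent_pt r \<in> p" "regulus_pt r \<notin> p"
    then obtain s where "s \<noteq> r" "{x. cubic_pt x \<in> p} = {r, s}" "regulus_pt s \<in> p" "tangent_pt s \<notin> p"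
      by (rule roots_of_tangent_in_plane[OF assms r(1)])
    with * double_root[of s r] show thesis by (simp add: insert_commute)
  next
    assume *: "tangent_pt r \<notin> p" "regulus_pt r \<in> p"
    then obtain s where "s \<noteq> r" "{x. cubic_pt x \<in> p} = {r, s}" "tangent_pt s \<in> p" "regulus_pt s \<notin> p"
      using roots_of_regulus_in_plane[OF assms r(1)] by metis
    with * double_root[of r s] show thesis by simp
  qed (use r in blast)
qed

lemma card_roots_le_3:
  assumes "(p :: ('a ^ 4) set) \<in> pg_planes"
  shows "card {x. cubic_pt x \<in> p} \<le> 3"
proof -
  obtain c0 c1 c2 c3
    where c: "\<not> (c0 = 0 \<and> c1 = 0 \<and> c2 = 0 \<and> c3 = 0)" and p: "p = plane c0 c1 c2 c3"
    using assms by (rule pg_planeE)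
  define f where "f = [:c3, c2, c1, c0:]"
  have "poly f x = c0 * x ^ 3 + c1 * x ^ 2 + c2 * x + c3" for x
    by (simp add: f_def power2_eq_square power3_eq_cube algebra_simps)
  then have fin: "cubic_pt (Some x) \<in> p \<longleftrightarrow> poly f x = 0" for x
    by (simp add: p plane_def)
  have inf: "cubic_pt None \<in> p \<longleftrightarrow> c0 = 0"
    by (simp add: p plane_def)
  have "f \<noteq> 0" using c by (auto simp: f_def)
  then have f: "card {x. poly f x = 0} \<le> degree f"
    by (rule card_poly_roots_bound)
  show ?thesis
  \<comment> \<open>Infinity is a root exactly when \<open>c0 = 0\<close>, and then the degree drops
    to at most 2, which makes room for it.\<close>
  proof (cases "c0 = 0")
    case True
    then have "{x. cubic_pt x \<in> p} = insert None (Some ` {x. poly f x = 0})"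
      using fin inf by (auto simp: set_eq_iff image_iff split_option_all)
    moreover have "degree f \<le> 2"
      by (auto simp: f_def True)
    ultimately show ?thesis
      using f by (simp add: card_image)
  next
    case False
    then have "{x. cubic_pt x \<in> p} = Some ` {x. poly f x = 0}"
      using fin inf by (auto simp: set_eq_iff image_iff split_option_all)
    moreover have "degree f \<le> 3"
      by (simp add: f_def)
    ultimately show ?thesis
      using f by (simp add: card_image)
  qed
qed

subsection \<open>Incidences with the two families of lines\<close>

definition regulus_lines :: "('a ^ 4) set set" where
  "regulus_lines = range (\<lambda>r. uline r 0)"

definition general_lines :: "('a ^ 4) set set" where
  "general_lines = {uline r u | r u. u \<noteq> 0}"

lemma uline_in_general_lines: "u \<noteq> 0 \<Longrightarrow> uline r u \<in> general_lines"
  by (auto simp: general_lines_def)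

lemma card_regulus_lines: "card regulus_lines = CARD('a) + 1"
  unfolding regulus_lines_def
  by (subst card_image) (auto simp: inj_def uline_eq_iff card_UNIV_option)

lemma card_general_lines: "card general_lines = CARD('a)\<^sup>2 - 1"
proof -
  have eq: "general_lines = (\<lambda>(r, u). uline r u) ` (UNIV \<times> (UNIV - {0}))"
    by (auto simp: general_lines_def)
  have "inj_on (\<lambda>(r::'a option, u). uline r u) (UNIV \<times> (UNIV - {0}))"
    by (auto simp: inj_on_def uline_eq_iff)
  then have "card general_lines = (CARD('a) + 1) * (CARD('a) - 1)"
    unfolding eq by (subst card_image) (simp_all add: card_cartesian_product card_UNIV_option)
  then show ?thesis
    by (simp add: algebra_simps power2_eq_square)
qed

lemma roots_of_osc_plane: "{x. cubic_pt x \<in> osc_plane r} = {r :: 'a option}"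
  by (simp add: cubic_pt_in_osc_plane)

lemma d_planes_iff:
  fixes p :: "('a ^ 4) set"
  shows "p \<in> d_planes d \<longleftrightarrow> p \<in> pg_planes \<and> card {x. cubic_pt x \<in> p} = d"
  unfolding d_planes_def using card_points_eq[OF subspace_pg_plane] by auto

lemma osc_plane_in_d_planes: "osc_plane (r :: 'a option) \<in> d_planes d \<longleftrightarrow> d = 1"
  by (auto simp: d_planes_iff osc_plane_in_pg_planes roots_of_osc_plane)

lemma one_bar_planes_iff:
  fixes p :: "('a ^ 4) set"
  shows "p \<in> one_bar_planes \<longleftrightarrow>
    p \<in> pg_planes \<and> card {x. cubic_pt x \<in> p} = 1 \<and> p \<notin> range osc_plane"
  by (auto simp: one_bar_planes_def d_planes_iff Gamma_planes_eq)

lemma lines_in_osc_plane: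
  fixes r :: "'a option"
  shows "lines_in regulus_lines (osc_plane r) = 1"
    and "lines_in general_lines (osc_plane r) = CARD('a) - 1"
proof -
  have "{l \<in> regulus_lines. l \<subseteq> osc_plane r} = {uline r 0}"
    by (auto simp: regulus_lines_def uline_subset_osc_plane dest: in_osc_plane_if_in_uline)
  then show "lines_in regulus_lines (osc_plane r) = 1"
    by (simp add: lines_in_def)
  have "{l \<in> general_lines. l \<subseteq> osc_plane r} = uline r ` (UNIV - {0})"
    by (auto simp: general_lines_def uline_subset_osc_plane dest: in_osc_plane_if_in_uline)
  moreover have "inj (uline r)"
    by (simp add: inj_def uline_eq_iff)
  ultimately show "lines_in general_lines (osc_plane r) = CARD('a) - 1"
    by (simp add: lines_in_def card_image inj_on_subset)
qed

text \<open>At \<open>s\<close> no line fits, since containing the tangent point would bring in the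
  regulus point too. At \<open>r\<close> the pencil of lines meets \<open>p\<close> only at
  \<open>u = 0\<close>.\<close>

lemma lines_in_double_root_plane:
  fixes r s :: "'a option"
  assumes p: "p \<in> pg_planes" "{x. cubic_pt x \<in> p} = {r, s}"
    "regulus_pt r \<in> p" "tangent_pt r \<notin> p" "tangent_pt s \<in> p" "regulus_pt s \<notin> p"
  shows "lines_in regulus_lines p = 1" and "lines_in general_lines p = 0"
proof -
  have "uline x u \<subseteq> p \<longleftrightarrow> x = r \<and> u = 0" for x u
  proof -
    have "uline x u \<subseteq> p \<longleftrightarrow> (x = r \<or> x = s) \<and> regulus_pt x + u *s tangent_pt x \<in> p"
      using p(2) uline_subset_iff[OF subspace_pg_plane[OF p(1)]] by blast
    moreover have "regulus_pt s + u *s tangent_pt s \<notin> p"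
      using p subspace_pg_plane[OF p(1)] vec.subspace_scale vec.subspace_add
      by (metis add_diff_cancel_right' vec.subspace_diff)
    moreover have "regulus_pt r + u *s tangent_pt r \<in> p \<longleftrightarrow> u = 0"
      using ex1_point_on_pencil[OF p(1,4), of "regulus_pt r"] p(3)
      by (metis add.right_neutral vec.scale_zero_left)
    ultimately show ?thesis by auto
  qed
  then have "{l \<in> regulus_lines. l \<subseteq> p} = {uline r 0}" "{l \<in> general_lines. l \<subseteq> p} = {}"
    by (auto simp: regulus_lines_def general_lines_def)
  then show "lines_in regulus_lines p = 1" "lines_in general_lines p = 0"
    by (simp_all add: lines_in_def)
qed

lemma lines_in_simple_roots_plane:
  fixes p :: "('a ^ 4) set"
  assumes p: "p \<in> pg_planes"
    and simple: "\<And>r. cubic_pt r \<in> p \<Longrightarrow> tangent_pt r \<notin> p \<and> regulus_pt r \<notin> p"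
  shows "lines_in regulus_lines p = 0"
    and "lines_in general_lines p = card {r. cubic_pt r \<in> p}"
proof -
  let ?Z = "{r. cubic_pt r \<in> p}"
  \<comment> \<open>Each root contributes one line. Its parameter \<open>h r\<close> is nonzero
    because \<open>u = 0\<close> would put the regulus point in \<open>p\<close>.\<close>
  have "\<exists>u. \<forall>v. regulus_pt r + v *s tangent_pt r \<in> p \<longleftrightarrow> v = u" if "r \<in> ?Z" for r
    using ex1_point_on_pencil[OF p, of "tangent_pt r" "regulus_pt r"] simple that by blast
  then obtain h where h: "\<And>r v. r \<in> ?Z \<Longrightarrow> regulus_pt r + v *s tangent_pt r \<in> p \<longleftrightarrow> v = h r"
    by metis
  have nz: "h r \<noteq> 0" if "r \<in> ?Z" for r
    using h[OF that, of 0] simple that by auto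
  have sub: "uline r u \<subseteq> p \<longleftrightarrow> r \<in> ?Z \<and> u = h r" for r u
    using uline_subset_iff[OF subspace_pg_plane[OF p]] h by blast
  then have "{l \<in> regulus_lines. l \<subseteq> p} = {}"
    using nz by (auto simp: regulus_lines_def)
  then show "lines_in regulus_lines p = 0"
    by (simp add: lines_in_def)
  have "{l \<in> general_lines. l \<subseteq> p} = {uline r u | r u. u \<noteq> 0 \<and> uline r u \<subseteq> p}"
    by (auto simp: general_lines_def)
  also have "\<dots> = (\<lambda>r. uline r (h r)) ` ?Z"
    unfolding sub using nz by auto
  finally have "{l \<in> general_lines. l \<subseteq> p} = (\<lambda>r. uline r (h r)) ` ?Z" .
  moreover have "inj_on (\<lambda>r. uline r (h r)) ?Z"
    by (simp add: inj_on_def uline_eq_iff)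
  ultimately show "lines_in general_lines p = card {r. cubic_pt r \<in> p}"
    by (simp add: lines_in_def card_image)
qed

lemma lines_in_2_plane:
  fixes p :: "('a ^ 4) set"
  assumes "p \<in> d_planes 2"
  shows "lines_in regulus_lines p = 1" and "lines_in general_lines p = 0"
proof -
  have p: "p \<in> pg_planes" "card {x. cubic_pt x \<in> p} = 2"
    using assms by (simp_all add: d_planes_iff)
  from p(1) have "lines_in regulus_lines p = 1 \<and> lines_in general_lines p = 0"
  proof (cases p rule: plane_trichotomy)
    case (osculating r)
    then show ?thesis using p(2) by (simp add: roots_of_osc_plane)
  next
    case (double_root r s)
    then show ?thesis
      using lines_in_double_root_plane[OF p(1) double_root(2-6)] by simp
  qed (use p in simp)
  then show "lines_in regulus_lines p = 1" "lines_in general_lines p = 0" by simp_all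
qed

lemma lines_in_non_2_plane:
  fixes p :: "('a ^ 4) set"
  assumes "p \<in> pg_planes" "p \<notin> range osc_plane" "card {x. cubic_pt x \<in> p} \<noteq> 2"
  shows "lines_in regulus_lines p = 0" and "lines_in general_lines p = card {x. cubic_pt x \<in> p}"
proof -
  from assms(1) have "lines_in regulus_lines p = 0 \<and>
    lines_in general_lines p = card {x. cubic_pt x \<in> p}"
  proof (cases p rule: plane_trichotomy)
    case simple_roots
    then show ?thesis using lines_in_simple_roots_plane[OF assms(1)] by blast
  qed (use assms in auto)
  then show "lines_in regulus_lines p = 0" "lines_in general_lines p = card {x. cubic_pt x \<in> p}"
    by simp_all
qed

lemma lines_in_eq_0_iff:
  "lines_in L p = 0 \<longleftrightarrow> (\<forall>l \<in> L. \<not> l \<subseteq> p)" for L :: "('a ^ 4) set set"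
  by (auto simp: lines_in_def)

text \<open>The counts of lines in planes are read backwards: a plane that contains such a line has
  a nonzero count, which excludes 0 and 2 points.\<close>

lemma card_roots_general_line:
  fixes p :: "('a ^ 4) set"
  assumes "p \<in> pg_planes" "l \<in> general_lines" "l \<subseteq> p" "p \<notin> range osc_plane"
  shows "card {x. cubic_pt x \<in> p} = 1 \<or> card {x. cubic_pt x \<in> p} = 3"
proof -
  have "lines_in general_lines p \<noteq> 0"
    using assms(2,3) lines_in_eq_0_iff by blast
  moreover from this have "card {x. cubic_pt x \<in> p} \<noteq> 2"
    using lines_in_2_plane(2) assms(1) d_planes_iff by metis
  ultimately have "card {x. cubic_pt x \<in> p} \<noteq> 0" "card {x. cubic_pt x \<in> p} \<noteq> 2"
    using lines_in_non_2_plane(2)[OF assms(1,4)] by simp_all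
  then show ?thesis
    using card_roots_le_3[OF assms(1)] by linarith
qed

lemma card_roots_regulus_line:
  fixes p :: "('a ^ 4) set"
  assumes "p \<in> pg_planes" "l \<in> regulus_lines" "l \<subseteq> p" "p \<notin> range osc_plane"
  shows "card {x. cubic_pt x \<in> p} = 2"
proof (rule ccontr)
  assume "card {x. cubic_pt x \<in> p} \<noteq> 2"
  then have "lines_in regulus_lines p = 0"
    by (rule lines_in_non_2_plane(1)[OF assms(1,4)])
  then show False
    using assms(2,3) by (simp add: lines_in_eq_0_iff)
qed

section \<open>Planes through a line of either family\<close>

lemma planes_through_Gamma:
  fixes r :: "'a option"
  shows "planes_through Gamma_planes (uline r u) = 1"
proof -
  have "{p \<in> Gamma_planes. uline r u \<subseteq> p} = {osc_plane r}"
    by (auto simp: Gamma_planes_eq uline_subset_osc_plane dest: in_osc_plane_if_in_uline)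
  then show ?thesis by (simp add: planes_through_def)
qed

text \<open>At the parameter 0 the incidence conditions reduce to \<open>c3 = 0\<close> and
  \<open>c1 = c2 * u\<close>. The osculating plane is the member with \<open>c2 = 0\<close>; the
  others are normalised to \<open>c2 = 1\<close>.\<close>

lemma planes_through_base_line:
  "{p \<in> pg_planes. uline (Some 0) u \<subseteq> p}
    = insert (osc_plane (Some 0)) (range (\<lambda>c::'a. plane c u 1 0))"
proof (intro equalityI subsetI)
  fix p assume "p \<in> {p \<in> pg_planes. uline (Some (0::'a)) u \<subseteq> p}"
  then have p: "p \<in> pg_planes" and sub: "uline (Some 0) u \<subseteq> p" by auto
  obtain c0 c1 c2 c3
    where c: "\<not> (c0 = 0 \<and> c1 = 0 \<and> c2 = 0 \<and> c3 = 0)" and p: "p = plane c0 c1 c2 c3"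
    using p by (rule pg_planeE)
  have c3: "c3 = 0" and c1: "c1 = c2 * u"
    using sub unfolding p uline_subset_iff[OF subspace_plane]
    by (simp_all add: plane_def add_eq_0_iff_eq)
  show "p \<in> insert (osc_plane (Some 0)) (range (\<lambda>c::'a. plane c u 1 0))"
  proof (cases "c2 = 0")
    case True
    then show ?thesis
      using c c1 c3 plane_scale[of c0 1 0 0 0] by (simp add: p)
  next
    case False
    then have "p = plane (c0 / c2) u 1 0"
      using c1 c3 plane_scale[of c2 "c0 / c2" u 1 0] by (simp add: p)
    then show ?thesis by blast
  qed
next
  fix p :: "('a ^ 4) set"
  assume "p \<in> insert (osc_plane (Some 0)) (range (\<lambda>c::'a. plane c u 1 0))"
  then consider "p = osc_plane (Some 0)" | c where "p = plane c u 1 0" by blast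
  then show "p \<in> {p \<in> pg_planes. uline (Some 0) u \<subseteq> p}"
  proof cases
    case 1
    then show ?thesis
      by (simp add: osc_plane_in_pg_planes uline_subset_osc_plane del: osc_plane.simps)
  next
    case 2
    have "uline (Some 0) u \<subseteq> p"
      unfolding 2 uline_subset_iff[OF subspace_plane] by (simp add: plane_def)
    then show ?thesis
      by (auto simp: 2 intro: plane_in_pg_planes)
  qed
qed

lemma inj_plane: "inj (\<lambda>c::'a. plane c u 1 0)"
proof (rule injI)
  fix c d :: 'a
  assume "plane c u 1 0 = plane d u 1 0"
  moreover have "vector [1, 0, c, 0] \<in> plane c u 1 0"
    by (simp add: plane_def)
  ultimately have "vector [1, 0, c, 0] \<in> plane d u 1 0" by simp
  then show "c = d"
    by (simp add: plane_def add_eq_0_iff_eq)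
qed

lemma osc_plane_notin_pencil: "osc_plane (Some 0) \<notin> range (\<lambda>c::'a. plane c u 1 0)"
proof
  assume "osc_plane (Some 0) \<in> range (\<lambda>c::'a. plane c u 1 0)"
  then obtain c :: 'a where eq: "osc_plane (Some 0) = plane c u 1 0" by blast
  have "tangent_pt (Some 0) \<in> osc_plane (Some (0::'a))"
    by (simp add: plane_def)
  then have "tangent_pt (Some 0) \<in> plane c u 1 0"
    unfolding eq .
  then show False
    by (simp add: plane_def)
qed

lemma planes_through_base_line_card:
  "planes_through pg_planes (uline (Some (0::'a)) u) = CARD('a) + 1"
  unfolding planes_through_def planes_through_base_line
  by (simp add: osc_plane_notin_pencil card_image[OF inj_plane] del: osc_plane.simps)

text \<open>Every fibre of the Artin-Schreier map has the form \<open>{z, z + 1}\<close>, and the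
  fibres partition the field. The equation also records that the field has even size.\<close>

lemma card_artin_schreier_image: "2 * card (range (\<lambda>y::'a. y ^ 2 + y)) = CARD('a)"
proof -
  let ?h = "\<lambda>y::'a. y ^ 2 + y"
  have "card {y. ?h y = ?h z} = 2" for z
  proof -
    have "?h y = ?h z \<longleftrightarrow> y = z \<or> y = z + 1" for y
    proof -
      have "?h y + ?h z = (y + z) * (y + (z + 1))"
        by (simp add: power2_eq_square distrib_left distrib_right ac_simps)
      then have "?h y = ?h z \<longleftrightarrow> (y + z) * (y + (z + 1)) = 0"
        by (metis add_eq_0_iff_eq)
      then show ?thesis
        by (simp only: mult_eq_0_iff add_eq_0_iff_eq)
    qed
    then have "{y. ?h y = ?h z} = {z, z + 1}" by blast
    then show ?thesis by simp
  qed
  then have "(\<Sum>b\<in>range ?h. card {y. ?h y = b}) = (\<Sum>b\<in>range ?h. 2)"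
    by (intro sum.cong) auto
  moreover have "(\<Sum>b\<in>range ?h. card {y. ?h y = b}) = CARD('a)"
    using sum.image_gen[of "UNIV :: 'a set" "\<lambda>_. 1::nat" ?h] by simp
  ultimately show ?thesis by simp
qed

lemma planes_through_base_line_3:
  "planes_through (d_planes 3) (uline (Some (0::'a)) 1) = CARD('a) div 2"
proof -
  have three: "plane c 1 1 0 \<in> d_planes 3 \<longleftrightarrow> c \<in> range (\<lambda>y. y ^ 2 + y)" for c :: 'a
  proof -
    let ?p = "plane c 1 1 0"
    define Z where "Z = {x. cubic_pt x \<in> ?p}"
    have p: "?p \<in> pg_planes" "uline (Some 0) 1 \<subseteq> ?p"
      using planes_through_base_line[of 1] by auto
    have "?p \<notin> range osc_plane"
    proof
      assume "?p \<in> range osc_plane"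
      then obtain r where r: "?p = osc_plane r" by blast
      then have "r = Some 0"
        using p(2) uline_subset_osc_plane[of "Some 0" 1 r] by simp
      then have "osc_plane (Some 0) = plane c 1 1 0"
        using r by simp
      then show False
        using osc_plane_notin_pencil[of 1] by (metis rangeI)
    qed
    moreover have "uline (Some 0) 1 \<in> general_lines"
      by (rule uline_in_general_lines) simp
    \<comment> \<open>With only 1 and 3 possible, one root besides \<open>Some 0\<close> already
      decides for 3.\<close>
    ultimately have Z: "card Z = 1 \<or> card Z = 3"
      unfolding Z_def using card_roots_general_line[OF p(1) _ p(2)] by metis
    have "Some 0 \<in> Z"
      by (simp add: Z_def plane_def)
    then have "card Z = 1 \<longleftrightarrow> \<not> (\<exists>s \<in> Z. s \<noteq> Some 0)"
      by (auto simp: card_1_singleton_iff)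
    with Z have "card Z = 3 \<longleftrightarrow> (\<exists>s \<in> Z. s \<noteq> Some 0)"
      by auto
    \<comment> \<open>\<open>x \<noteq> 0\<close> is a root of \<open>c x\<^sup>2 + x + 1\<close> iff \<open>c = y\<^sup>2 + y\<close> for \<open>y = 1 / x\<close>; \<open>x = \<infinity>\<close> is \<open>y = 0\<close>.\<close>
    also have "\<dots> \<longleftrightarrow> c \<in> range (\<lambda>y. y ^ 2 + y)"
    proof
      assume "\<exists>s \<in> Z. s \<noteq> Some 0"
      then obtain s where s: "s \<in> Z" "s \<noteq> Some 0" by blast
      show "c \<in> range (\<lambda>y. y ^ 2 + y)"
      proof (cases s)
        case None
        then have "c = 0 ^ 2 + 0" using s by (simp add: Z_def plane_def)
        then show ?thesis by blast
      next
        case (Some x)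
        then have x: "x \<noteq> 0" and "c * x ^ 3 + x ^ 2 + x = 0"
          using s by (simp_all add: Z_def plane_def)
        then have "x * (c * x ^ 2 + (x + 1)) = 0"
          by (simp add: power2_eq_square power3_eq_cube distrib_left ac_simps)
        then have "c * x ^ 2 = x + 1"
          using x by (simp only: mult_eq_0_iff add_eq_0_iff_eq) simp
        then have "c = (x + 1) / x ^ 2"
          using x by (simp add: nonzero_eq_divide_eq)
        also have "\<dots> = (1 / x) ^ 2 + 1 / x"
          using x by (simp add: add_divide_distrib power2_eq_square add.commute)
        finally have "c = (1 / x) ^ 2 + 1 / x" .
        then show ?thesis by blast
      qed
    next
      assume "c \<in> range (\<lambda>y. y ^ 2 + y)"
      then obtain y where y: "c = y ^ 2 + y" by blast
      show "\<exists>s \<in> Z. s \<noteq> Some 0"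
      proof (cases "y = 0")
        case True
        then have "None \<in> Z" by (simp add: Z_def y plane_def)
        then show ?thesis by blast
      next
        case False
        have "(y ^ 2 + y) * z ^ 3 = (y * z) ^ 2 * z + (y * z) * z ^ 2" for z
          by (simp add: power2_eq_square power3_eq_cube algebra_simps)
        from this[of "1 / y"] False have "c * (1 / y) ^ 3 + (1 / y) ^ 2 + 1 / y = 0"
          by (simp add: y ac_simps)
        then have "Some (1 / y) \<in> Z"
          by (simp add: Z_def plane_def)
        moreover have "Some (1 / y) \<noteq> Some 0"
          using False by simp
        ultimately show ?thesis by (rule bexI[rotated])
      qed
    qed
    finally show ?thesis using p(1) by (simp add: Z_def d_planes_iff)
  qed
  have "{p \<in> d_planes 3. uline (Some (0::'a)) 1 \<subseteq> p}
      = {p \<in> {p \<in> pg_planes. uline (Some 0) 1 \<subseteq> p}. p \<in> d_planes 3}"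
    by (auto simp: d_planes_iff)
  also have "\<dots> = (\<lambda>c. plane c 1 1 0) ` range (\<lambda>y::'a. y ^ 2 + y)"
    unfolding planes_through_base_line using three osc_plane_in_d_planes[of "Some 0" 3] by auto
  finally have "planes_through (d_planes 3) (uline (Some (0::'a)) 1) = card (range (\<lambda>y::'a. y ^ 2 + y))"
    unfolding planes_through_def by (simp only: card_image[OF inj_on_subset[OF inj_plane subset_UNIV]])
  then show ?thesis
    using card_artin_schreier_image by linarith
qed

subsection \<open>The two orbits\<close>

lemma matrix_vector_mult_4:
  "vector [vector [a11, a12, a13, a14], vector [a21, a22, a23, a24],
      vector [a31, a32, a33, a34], vector [a41, a42, a43, a44]] *v (x :: 'a ^ 4)
    = (vector [a11 * x $ 1 + a12 * x $ 2 + a13 * x $ 3 + a14 * x $ 4,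
        a21 * x $ 1 + a22 * x $ 2 + a23 * x $ 3 + a24 * x $ 4,
        a31 * x $ 1 + a32 * x $ 2 + a33 * x $ 3 + a34 * x $ 4,
        a41 * x $ 1 + a42 * x $ 2 + a43 * x $ 3 + a44 * x $ 4] :: 'a ^ 4)"
  by (simp add: vec_eq_iff forall_4 matrix_vector_mult_def sum_4)

lemma ex_translation:
  "\<exists>A \<in> cubic_matrices. (*v) A ` uline (Some 0) u = uline (Some (c::'a)) u"
proof -
  \<comment> \<open>The rows expand the powers of \<open>t + c\<close>. The zero in the second row
    is the vanishing middle term of the square.\<close>
  define A :: "'a ^ 4 ^ 4" where
    "A = vector [vector [1, c, c^2, c^3], vector [0, 1, 0, c^2], vector [0, 0, 1, c], vector [0, 0, 0, 1]]"
  note Av = matrix_vector_mult_4[of 1 c "c^2" "c^3" 0 1 0 "c^2" 0 0 1 c 0 0 0 1, folded A_def]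
  have "A \<in> cubic_matrices"
  proof (rule cubic_matricesI)
    show "x = 0" if "A *v x = 0" for x
      using that unfolding Av by (auto simp: vec_eq_iff forall_4)
    show "\<exists>k s. k \<noteq> 0 \<and> A *v cubic_pt r = k *s cubic_pt s" for r
    proof (cases r)
      case None
      then show ?thesis
        unfolding Av by (intro exI[of _ 1] exI[of _ None]) (simp add: vec_eq_iff forall_4)
    next
      case (Some t)
      have "t ^ 3 + c * t ^ 2 + c ^ 2 * t + c ^ 3 = (t + c) ^ 3"
        by (simp add: power2_eq_square power3_eq_cube algebra_simps two_eq_0)
      then show ?thesis
        unfolding Av Some
        by (intro exI[of _ 1] exI[of _ "Some (t + c)"])
          (simp add: vec_eq_iff forall_4 square_add)
    qed
  qed
  moreover have "(*v) A ` uline (Some 0) u = uline (Some c) u"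
    by (rule image_uline[of _ _ 1 _ _ 1]) (simp_all add: Av vec_eq_iff forall_4 algebra_simps)
  ultimately show ?thesis by blast
qed

lemma ex_inversion: "\<exists>A \<in> cubic_matrices. (*v) A ` uline (Some 0) u = uline None (u :: 'a)"
proof -
  define A :: "'a ^ 4 ^ 4" where
    "A = vector [vector [0, 0, 0, 1], vector [0, 0, 1, 0], vector [0, 1, 0, 0], vector [1, 0, 0, 0]]"
  note Av = matrix_vector_mult_4[of 0 0 0 1 0 0 1 0 0 1 0 0 1 0 0 0, folded A_def]
  have "A \<in> cubic_matrices"
  proof (rule cubic_matricesI)
    show "x = 0" if "A *v x = 0" for x
      using that unfolding Av by (auto simp: vec_eq_iff forall_4)
    show "\<exists>k s. k \<noteq> 0 \<and> A *v cubic_pt r = k *s cubic_pt s" for r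
    proof (cases r)
      case None
      then show ?thesis
        unfolding Av by (intro exI[of _ 1] exI[of _ "Some 0"]) (simp add: vec_eq_iff forall_4)
    next
      case (Some t)
      show ?thesis
      proof (cases "t = 0")
        case True
        then show ?thesis
          unfolding Av Some by (intro exI[of _ 1] exI[of _ None]) (simp add: vec_eq_iff forall_4)
      next
        case False
        then show ?thesis
          unfolding Av Some
          \<comment> \<open>Reversing the coordinates gives the point at \<open>1 / t\<close> with
            denominators cleared by \<open>t ^ 3\<close>.\<close>
          by (intro exI[of _ "t ^ 3"] exI[of _ "Some (1 / t)"])
            (simp add: vec_eq_iff forall_4 power2_eq_square power3_eq_cube)
      qed
    qed
  qed
  moreover have "(*v) A ` uline (Some 0) u = uline None u"
    by (rule image_uline[of _ _ 1 _ _ 1]) (simp_all add: Av vec_eq_iff forall_4)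
  ultimately show ?thesis by blast
qed

lemma ex_scaling:
  assumes "a \<noteq> (0::'a)"
  shows "\<exists>A \<in> cubic_matrices. (*v) A ` uline (Some 0) 1 = uline (Some 0) (1 / a)"
proof -
  define A :: "'a ^ 4 ^ 4" where
    "A = vector [vector [a^3, 0, 0, 0], vector [0, a^2, 0, 0], vector [0, 0, a, 0], vector [0, 0, 0, 1]]"
  note Av = matrix_vector_mult_4[of "a^3" 0 0 0 0 "a^2" 0 0 0 0 a 0 0 0 0 1, folded A_def]
  have "A \<in> cubic_matrices"
  proof (rule cubic_matricesI)
    show "x = 0" if "A *v x = 0" for x
      using that assms unfolding Av by (auto simp: vec_eq_iff forall_4)
    show "\<exists>k s. k \<noteq> 0 \<and> A *v cubic_pt r = k *s cubic_pt s" for r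
    proof (cases r)
      case None
      then show ?thesis
        unfolding Av using assms
        by (intro exI[of _ "a ^ 3"] exI[of _ None]) (simp add: vec_eq_iff forall_4)
    next
      case (Some t)
      then show ?thesis
        unfolding Av
        by (intro exI[of _ 1] exI[of _ "Some (a * t)"])
          (simp add: vec_eq_iff forall_4 power_mult_distrib)
    qed
  qed
  moreover have "(*v) A ` uline (Some 0) 1 = uline (Some 0) (1 / a)"
    \<comment> \<open>At the parameter 0 the regulus point is scaled by \<open>a ^ 2\<close> and the
      tangent point by \<open>a\<close>, so \<open>u\<close> is divided by \<open>a\<close>.\<close>
    by (rule image_uline[of _ _ 1 _ _ "a ^ 2"])
      (use assms in \<open>simp_all add: Av vec_eq_iff forall_4 power2_eq_square\<close>)
  ultimately show ?thesis by blast
qed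

lemma ex_move_base:
  fixes r :: "'a option"
  shows "\<exists>A \<in> cubic_matrices. (*v) A ` uline (Some 0) u = uline r u"
  by (cases r) (simp_all only: ex_translation ex_inversion)

lemma ex_move_base_1:
  fixes r :: "'a option"
  assumes "u \<noteq> 0"
  shows "\<exists>A \<in> cubic_matrices. (*v) A ` uline (Some 0) 1 = uline r u"
proof -
  obtain A where A: "A \<in> cubic_matrices" "(*v) A ` uline (Some 0) 1 = uline (Some 0) u"
    using ex_scaling[of "1 / u"] assms by auto
  obtain B where B: "B \<in> cubic_matrices" "(*v) B ` uline (Some 0) u = uline r u"
    using ex_move_base by blast
  have "(*v) (B ** A) ` uline (Some 0) 1 = (*v) B ` (*v) A ` uline (Some 0) 1"
    by (simp add: image_image matrix_vector_mul_assoc)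
  also have "\<dots> = uline r u"
    by (simp only: A(2) B(2))
  finally show ?thesis
    using cubic_matrices_mult[OF B(1) A(1)] by blast
qed

lemma ex_cubic_matrix_uline:
  fixes r s :: "'a option"
  assumes "u = 0 \<longleftrightarrow> v = 0"
  shows "\<exists>A \<in> cubic_matrices. (*v) A ` uline r u = uline s v"
proof -
  \<comment> \<open>Both lines are images of the same representative,
    \<open>uline (Some 0) 0\<close> or \<open>uline (Some 0) 1\<close>.\<close>
  define w :: 'a where "w = (if u = 0 then 0 else 1)"
  obtain A where A: "A \<in> cubic_matrices" "(*v) A ` uline (Some 0) w = uline r u"
    using ex_move_base[of 0 r] ex_move_base_1[of u r] unfolding w_def by (cases "u = 0") auto
  obtain B where B: "B \<in> cubic_matrices" "(*v) B ` uline (Some 0) w = uline s v"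
    using ex_move_base[of 0 s] ex_move_base_1[of v s] assms unfolding w_def
    by (cases "v = 0") auto
  obtain A' where A': "A' \<in> cubic_matrices" "\<forall>S. (*v) A' ` (*v) A ` S = S"
    using A(1) by (rule cubic_matrices_inverse)
  have "(*v) (B ** A') ` uline r u = (*v) B ` (*v) A' ` (*v) A ` uline (Some 0) w"
    unfolding A(2) by (simp add: image_image matrix_vector_mul_assoc)
  also have "\<dots> = uline s v"
    by (simp only: A'(2) B(2))
  finally show ?thesis
    using cubic_matrices_mult[OF B(1) A'(1)] by blast
qed

section \<open>Plane counts carried along the two families\<close>

lemma planes_through_uline_card:
  fixes r :: "'a option"
  shows "planes_through pg_planes (uline r u) = CARD('a) + 1"
proof -
  obtain A where A: "A \<in> cubic_matrices" "(*v) A ` uline (Some 0) u = uline r u"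
    using ex_move_base by blast
  have "planes_through pg_planes (uline r u) = planes_through pg_planes (uline (Some 0) u)"
    unfolding A(2)[symmetric] by (rule planes_through_image) (use pg_planes_image A(1) in auto)
  then show ?thesis by (simp add: planes_through_base_line_card)
qed

text \<open>One of the \<open>q + 1\<close> planes through the line is osculating, and all others
  meet the cubic in two points. The value \<open>d = 1\<close> is set aside because of the
  osculating plane.\<close>

lemma planes_through_regulus_line:
  fixes l :: "('a ^ 4) set"
  assumes "l \<in> regulus_lines"
  shows "planes_through (d_planes 2) l = CARD('a)"
    and "d \<noteq> 2 \<Longrightarrow> d \<noteq> 1 \<Longrightarrow> planes_through (d_planes d) l = 0"
    and "planes_through one_bar_planes l = 0"
proof -
  obtain r where l: "l = uline r 0"
    using assms by (auto simp: regulus_lines_def)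
  have "p \<in> d_planes 2" if "p \<in> pg_planes" "l \<subseteq> p" "p \<noteq> osc_plane r" for p
  proof -
    have "p \<notin> range osc_plane"
      using that(2,3) uline_subset_osc_plane unfolding l by auto
    then show ?thesis
      using card_roots_regulus_line[OF that(1) assms that(2)] that(1) by (simp add: d_planes_iff)
  qed
  then have "{p \<in> d_planes 2. l \<subseteq> p} = {p \<in> pg_planes. l \<subseteq> p} - {osc_plane r}"
    using osc_plane_in_d_planes[of r 2] d_planes_iff by auto
  moreover have "osc_plane r \<in> {p \<in> pg_planes. l \<subseteq> p}"
    by (simp add: l osc_plane_in_pg_planes uline_subset_osc_plane)
  ultimately show "planes_through (d_planes 2) l = CARD('a)"
    using planes_through_uline_card[of r 0] by (simp add: planes_through_def l card_Diff_singleton)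
  have "{p \<in> d_planes d. l \<subseteq> p} = {}" if "d \<noteq> 2" "d \<noteq> 1" for d
  proof -
    have "card {x. cubic_pt x \<in> p} = 2" if "p \<in> d_planes d" "l \<subseteq> p" for p
      using that \<open>d \<noteq> 1\<close> osc_plane_in_d_planes
      by (intro card_roots_regulus_line[OF _ assms]) (auto simp: d_planes_iff)
    then show ?thesis
      using that by (auto simp: d_planes_iff)
  qed
  then show "d \<noteq> 2 \<Longrightarrow> d \<noteq> 1 \<Longrightarrow> planes_through (d_planes d) l = 0"
    by (simp add: planes_through_def)
  have "{p \<in> one_bar_planes. l \<subseteq> p} = {}"
  proof -
    have "card {x. cubic_pt x \<in> p} = 2" if "p \<in> one_bar_planes" "l \<subseteq> p" for p
      using that by (intro card_roots_regulus_line[OF _ assms]) (auto simp: one_bar_planes_iff)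
    then show ?thesis by (force simp: one_bar_planes_iff)
  qed
  then show "planes_through one_bar_planes l = 0"
    by (simp add: planes_through_def)
qed

text \<open>Of the \<open>q + 1\<close> planes one is osculating and \<open>q / 2\<close> have three
  points of the cubic. The remaining ones have exactly one point and are not osculating.\<close>

lemma planes_through_general_line:
  fixes l :: "('a ^ 4) set"
  assumes "l \<in> general_lines"
  shows "planes_through (d_planes 3) l = CARD('a) div 2"
    and "planes_through one_bar_planes l = CARD('a) div 2"
    and "d \<noteq> 1 \<Longrightarrow> d \<noteq> 3 \<Longrightarrow> planes_through (d_planes d) l = 0"
proof -
  obtain r u where l: "l = uline r u" and u: "u \<noteq> 0"
    using assms by (auto simp: general_lines_def)
  obtain A where A: "A \<in> cubic_matrices" "(*v) A ` uline (Some 0) 1 = uline r u"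
    using ex_move_base_1[OF u] by blast
  have "planes_through (d_planes 3) l = planes_through (d_planes 3) (uline (Some (0::'a)) 1)"
    unfolding l A(2)[symmetric] by (rule planes_through_image) (use d_planes_image A(1) in auto)
  then show three: "planes_through (d_planes 3) l = CARD('a) div 2"
    by (simp add: planes_through_base_line_3)
  have osc: "p = osc_plane r" if "p \<in> range osc_plane" "l \<subseteq> p" for p
    using that uline_subset_osc_plane unfolding l by auto
  have "{p \<in> one_bar_planes. l \<subseteq> p}
      = {p \<in> pg_planes. l \<subseteq> p} - insert (osc_plane r) {p \<in> d_planes 3. l \<subseteq> p}" (is "?L = ?R")
  proof (intro equalityI subsetI)
    fix p assume "p \<in> ?L"
    then show "p \<in> ?R" by (auto simp: one_bar_planes_iff d_planes_iff)
  next
    fix p assume p: "p \<in> ?R"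
    then have "p \<notin> range osc_plane" using osc by blast
    then show "p \<in> ?L"
      using p card_roots_general_line[OF _ assms, of p] by (auto simp: one_bar_planes_iff d_planes_iff)
  qed
  moreover have "card (insert (osc_plane r) {p \<in> d_planes 3. l \<subseteq> p}) = CARD('a) div 2 + 1"
    using three osc_plane_in_d_planes[of r 3] by (simp add: planes_through_def)
  moreover have "insert (osc_plane r) {p \<in> d_planes 3. l \<subseteq> p} \<subseteq> {p \<in> pg_planes. l \<subseteq> p}"
    by (auto simp: d_planes_iff osc_plane_in_pg_planes l in_osc_plane_if_in_uline)
  ultimately have "planes_through one_bar_planes l = CARD('a) + 1 - (CARD('a) div 2 + 1)"
    using planes_through_uline_card[of r u] by (simp add: planes_through_def card_Diff_subset l)
  then show "planes_through one_bar_planes l = CARD('a) div 2"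
    \<comment> \<open>Writing the field size as twice a number makes the truncated division
      exact.\<close>
    by (simp flip: card_artin_schreier_image)
  have "{p \<in> d_planes d. l \<subseteq> p} = {}" if "d \<noteq> 1" "d \<noteq> 3" for d
  proof -
    have "card {x. cubic_pt x \<in> p} = 1 \<or> card {x. cubic_pt x \<in> p} = 3"
      if "p \<in> d_planes d" "l \<subseteq> p" for p
      using that \<open>d \<noteq> 1\<close> osc_plane_in_d_planes
      by (intro card_roots_general_line[OF _ assms]) (auto simp: d_planes_iff)
    then show ?thesis
      using that by (auto simp: d_planes_iff)
  qed
  then show "d \<noteq> 1 \<Longrightarrow> d \<noteq> 3 \<Longrightarrow> planes_through (d_planes d) l = 0"
    by (simp add: planes_through_def)
qed

section \<open>Identification of the orbits with the two families\<close>

lemma cubic_pt_nonzero: "cubic_pt (r :: 'a option) \<noteq> 0"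
  by (cases r) (auto simp: vec_eq_iff forall_4)

lemma osc_plane_decomp:
  fixes r :: "'a option"
  assumes "v \<in> osc_plane r"
  obtains a b d where "v = a *s cubic_pt r + b *s regulus_pt r + d *s tangent_pt r"
proof (cases r)
  case None
  then have "v = v $ 1 *s cubic_pt r + v $ 3 *s regulus_pt r + v $ 2 *s tangent_pt r"
    using assms by (simp add: vec_eq_iff forall_4 plane_def)
  then show thesis by (rule that)
next
  case (Some t)
  have "v $ 1 = t * v $ 2 + t ^ 2 * v $ 3 + t ^ 3 * v $ 4"
    using assms Some by (simp add: plane_def add_eq_0_iff_eq add.assoc)
  then have "v = v $ 4 *s cubic_pt r + (v $ 2 + v $ 4 * t ^ 2) *s regulus_pt r
      + (v $ 3 + v $ 4 * t) *s tangent_pt r"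
    by (simp add: Some vec_eq_iff forall_4 power2_eq_square power3_eq_cube
        distrib_left distrib_right ac_simps)
  then show thesis by (rule that)
qed

text \<open>The point of the cubic on the line determines the osculating plane that contains it. A
  second point, decomposed in that plane, has a nonzero regulus component, as otherwise the line is
  the tangent. Dividing by it gives \<open>u\<close>.\<close>

lemma UGamma_line_eq_uline:
  assumes "(l :: ('a ^ 4) set) \<in> UGamma_lines"
  obtains r u where "l = uline r u"
proof -
  have l: "l \<in> pg_lines" and sub: "vec.subspace l" "vec.dim l = 2"
    and one: "card {x \<in> twisted_cubic. x \<subseteq> l} = 1" and tan: "l \<notin> tangents"
    using assms by (auto simp: UGamma_lines_def pg_lines_def)
  obtain s where s: "l \<subseteq> osc_plane s"
    using assms by (auto simp: UGamma_lines_def Gamma_planes_eq)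
  have "{r. cubic_pt r \<in> l} \<noteq> {}"
    using one unfolding card_points_eq[OF sub(1)] by (metis card.empty zero_neq_one)
  then obtain r where r: "cubic_pt r \<in> l" by blast
  then have "s = r"
    using subsetD[OF s r] cubic_pt_in_osc_plane[of r s] by simp
  have "\<not> l \<subseteq> vec.span {cubic_pt r}"
  proof
    assume "l \<subseteq> vec.span {cubic_pt r}"
    then have "vec.dim l \<le> card {cubic_pt r}"
      by (rule vec.dim_le_card) simp
    then show False using sub(2) by simp
  qed
  then obtain v where v: "v \<in> l" "v \<notin> vec.span {cubic_pt r}" by blast
  then obtain a b d where abd: "v = a *s cubic_pt r + b *s regulus_pt r + d *s tangent_pt r"
    using osc_plane_decomp[OF subsetD[OF s]] \<open>s = r\<close> by metis
  \<comment> \<open>Used twice: with the tangent point for a contradiction, and with the second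
    generator of \<open>uline r (d / b)\<close>.\<close>
  have in_line: "l = vec.span {cubic_pt r, w}" if "v = a *s cubic_pt r + k *s w" for k w
  proof -
    have "k \<noteq> 0"
      using that v(2) by (auto simp: vec.span_scale vec.span_base)
    moreover have "v - a *s cubic_pt r \<in> l"
      using v(1) r sub(1) by (intro vec.subspace_diff vec.subspace_scale)
    ultimately have "w \<in> l"
      using that vec.subspace_scale[OF sub(1), of "v - a *s cubic_pt r" "1 / k"] by simp
    moreover have "w \<notin> vec.span {cubic_pt r}"
      using that v(2) vec.span_add vec.span_scale vec.span_base by (metis singletonI)
    ultimately show ?thesis
      by (intro pg_line_eq_span[OF l r _ cubic_pt_nonzero])
  qed
  have "b \<noteq> 0"
  proof
    assume "b = 0"
    then have "l = vec.span {cubic_pt r, tangent_pt r}"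
      using abd by (intro in_line[of d]) simp
    then show False using tan by (simp add: tangents_eq)
  qed
  then have "v = a *s cubic_pt r + b *s (regulus_pt r + (d / b) *s tangent_pt r)"
    by (simp add: abd vec.scale_right_distrib add.assoc)
  then have "l = uline r (d / b)"
    unfolding uline_def by (rule in_line)
  then show thesis by (rule that)
qed

lemma UGamma_orbitE:
  assumes "(L :: ('a ^ 4) set set) \<in> UGamma_orbits"
  obtains r u where "L = {(*v) A ` uline r u | A. A \<in> cubic_matrices}"
proof -
  obtain l where l: "L = {g l | g. g \<in> cubic_group}" "l \<in> UGamma_lines"
    using assms by (auto simp: UGamma_orbits_def)
  obtain r u where l_eq: "l = uline r u"
    using l(2) by (rule UGamma_line_eq_uline)
  show thesis
    using that l(1) unfolding l_eq orbit_eq[OF subspace_uline] .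
qed

lemma UGamma_orbits_eq:
  assumes q: "CARD('a) \<ge> 3"
    and O1: "(O1 :: ('a ^ 4) set set) \<in> UGamma_orbits" "card O1 = CARD('a) + 1"
    and O2: "(O2 :: ('a ^ 4) set set) \<in> UGamma_orbits" "card O2 = CARD('a)\<^sup>2 - 1"
  shows "O1 = regulus_lines" and "O2 = general_lines"
proof -
  obtain r u where O1_eq: "O1 = {(*v) A ` uline r u | A. A \<in> cubic_matrices}"
    using O1(1) by (rule UGamma_orbitE)
  obtain s v where O2_eq: "O2 = {(*v) A ` uline s v | A. A \<in> cubic_matrices}"
    using O2(1) by (rule UGamma_orbitE)
  have "3 * CARD('a) \<le> CARD('a)\<^sup>2"
    using q by (simp add: power2_eq_square)
  then have lt: "CARD('a) + 1 < CARD('a)\<^sup>2 - 1"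
    using q by linarith
  have in_orbit: "uline y w \<in> {(*v) A ` uline x z | A. A \<in> cubic_matrices}"
    if "z = 0 \<longleftrightarrow> w = 0" for x y :: "'a option" and z w
    using ex_cubic_matrix_uline[OF that] by (metis (mono_tags, lifting) mem_Collect_eq)
  have general: "general_lines \<subseteq> {(*v) A ` uline x z | A. A \<in> cubic_matrices}" if "z \<noteq> 0" for x z
    using in_orbit that unfolding general_lines_def by auto
  have "u = 0"
  proof (rule ccontr)
    assume "u \<noteq> 0"
    then have "card general_lines \<le> card O1"
      unfolding O1_eq by (intro card_mono general) simp_all
    then show False using lt O1(2) by (simp add: card_general_lines)
  qed
  then have "regulus_lines \<subseteq> O1"
    using in_orbit[of u 0 _ r] unfolding O1_eq regulus_lines_def by auto
  then show O1': "O1 = regulus_lines"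
    using card_subset_eq[of O1 regulus_lines] O1(2) by (simp add: card_regulus_lines)
  \<comment> \<open>Containing the regulus lines would not contradict the larger size of
    \<open>O2\<close>. Instead, for \<open>v = 0\<close> the two base lines share an orbit, and
    \<open>O2\<close> would fit into the smaller \<open>O1\<close>.\<close>
  have "v \<noteq> 0"
  proof
    assume "v = 0"
    then obtain B where B: "B \<in> cubic_matrices" "(*v) B ` uline r u = uline s v"
      using \<open>u = 0\<close> ex_cubic_matrix_uline[of u v r s] by blast
    have "(*v) A ` uline s v = (*v) (A ** B) ` uline r u" for A
      unfolding B(2)[symmetric] by (simp add: image_image matrix_vector_mul_assoc)
    then have "O2 \<subseteq> O1"
      unfolding O1_eq O2_eq using cubic_matrices_mult[OF _ B(1)] by blast
    then have "card O2 \<le> card O1"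
      by (intro card_mono) simp_all
    then show False using lt O1(2) O2(2) by simp
  qed
  then have "general_lines \<subseteq> O2"
    unfolding O2_eq by (rule general)
  then show "O2 = general_lines"
    using card_subset_eq[of O2 general_lines] O2(2) by (simp add: card_general_lines)
qed

end

theorem theorem7p3:
  fixes q m :: nat
    and O1 O2 :: "('a::{field,finite} ^ 4) set set"
  assumes q_card: "CARD('a) = q"
    and q_pow: "q = 2 ^ m"
    and q_ge: "q \<ge> 8"
    and O1: "O1 \<in> UGamma_orbits" "card O1 = q + 1"
    and O2: "O2 \<in> UGamma_orbits" "card O2 = q\<^sup>2 - 1"
  shows
    "(\<forall>l \<in> O1. planes_through Gamma_planes l = 1) \<and>
     (\<forall>l \<in> O2. planes_through Gamma_planes l = 1) \<and>
     (\<forall>p \<in> Gamma_planes. lines_in O1 p = 1) \<and>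
     (\<forall>p \<in> d_planes 2. lines_in O1 p = 1) \<and>
     (\<forall>p \<in> one_bar_planes. lines_in O2 p = 1) \<and>
     (\<forall>l \<in> O1. planes_through (d_planes 2) l = q) \<and>
     (\<forall>T \<in> {d_planes 3, one_bar_planes, d_planes 0}.
        (\<forall>l \<in> O1. planes_through T l = 0) \<and> (\<forall>p \<in> T. lines_in O1 p = 0)) \<and>
     (\<forall>l \<in> O2. planes_through (d_planes 3) l = q div 2) \<and>
     (\<forall>l \<in> O2. planes_through one_bar_planes l = q div 2) \<and>
     (\<forall>T \<in> {d_planes 2, d_planes 0}.
        (\<forall>l \<in> O2. planes_through T l = 0) \<and> (\<forall>p \<in> T. lines_in O2 p = 0)) \<and>
     (\<forall>p \<in> Gamma_planes. lines_in O2 p = q - 1) \<and>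
     (\<forall>p \<in> d_planes 3. lines_in O2 p = 3)"
proof -
  interpret char_two_field "TYPE('a)"
    by unfold_locales (rule two_eq_0_of_card[of m], simp only: q_card q_pow)
  have O1_eq: "O1 = regulus_lines" and O2_eq: "O2 = general_lines"
    using UGamma_orbits_eq[of O1 O2] O1 O2 q_card q_ge by simp_all
  have d: "p \<in> pg_planes \<and> p \<notin> range osc_plane \<and> card {x. cubic_pt x \<in> p} = d"
    if "p \<in> d_planes d" "d \<noteq> 1" for p :: "('a ^ 4) set" and d
    using that osc_plane_in_d_planes by (auto simp: d_planes_iff)
  \<comment> \<open>The lines of \<open>O2\<close> in the plane match its points of the cubic;
    \<open>d = 3\<close> and \<open>d = 0\<close> yield the values 3 and 0.\<close>
  have non2: "lines_in O1 p = 0 \<and> lines_in O2 p = d"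
    if "p \<in> d_planes d" "d \<noteq> 1" "d \<noteq> 2" for p d
    using lines_in_non_2_plane[of p] d[of p d] that unfolding O1_eq O2_eq by auto
  have one_bar: "lines_in O1 p = 0 \<and> lines_in O2 p = 1" if "p \<in> one_bar_planes" for p
    using lines_in_non_2_plane[of p] that unfolding O1_eq O2_eq one_bar_planes_iff by auto
  have Gamma: "planes_through Gamma_planes l = 1" if "l \<in> O1 \<union> O2" for l
    using that planes_through_Gamma unfolding O1_eq O2_eq regulus_lines_def general_lines_def by auto
  have in_Gamma: "lines_in O1 p = 1 \<and> lines_in O2 p = q - 1" if "p \<in> Gamma_planes" for p
    using that lines_in_osc_plane q_card unfolding O1_eq O2_eq Gamma_planes_eq by auto
  show ?thesis
    using Gamma in_Gamma non2[of _ 3] non2[of _ 0] one_bar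
      lines_in_2_plane planes_through_regulus_line planes_through_general_line q_card
    unfolding O1_eq O2_eq by simp
qed

end
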